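(* For every complex $q$ with $|q|<1$, $$\varphi(q)\varphi(q^5) = 2 \left\{ \sum_{n=-\infty}^{\infty} \frac{q^n}{1 + q^{10n}} - \sum_{n=-\infty}^{\infty} \frac{q^{5n+2}}{1 + q^{10n+4}} \right\} = 2 \left\{ \sum_{n=-\infty}^{\infty} \frac{q^{3n}}{1 + q^{10n}} + \sum_{n=-\infty}^{\infty} \frac{q^{5n+1}}{1 + q^{10n+2}} \right\} = 1 + \sum_{n=1}^{\infty} \left(\frac{-20}{n}\right) \frac{q^n}{1 - q^n} + \sum_{n=1}^{\infty} \left(\frac{n}{5}\right) \frac{q^n}{1 + q^{2n}}.$$ Furthermore, $$1 + \sum_{n=1}^{\infty} \left(\frac{-20}{n}\right) \frac{q^n}{1 - q^n} = \frac{E(q^2)E(q^4)E(q^5)E(q^{10})}{E(q)E(q^{20})}$$ and $$\sum_{n=1}^{\infty} \left(\frac{n}{5}\right) \frac{q^n}{1+q^{2n}} = q \frac{E(q)E(q^2)E(q^{10})E(q^{20})}{E(q^4)E(q^5)}.$$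
   Context: For $|q|<1$: $E(q):=\prod_{n\ge 1}(1-q^n)$ and $\varphi(q):=\sum_{n=-\infty}^{\infty} q^{n^2}$. $\left(\frac{a}{n}\right)$ denotes the Kronecker symbol; $\left(\frac{n}{5}\right)$ is the Legendre symbol modulo 5 (equal to $0$ when $5\mid n$). *)

theory Defs
  imports "HOL-Analysis.Analysis" "HOL-Number_Theory.Number_Theory"
begin

(* The library product is indexed from 0, hence the shift by one in the exponent. *)
definition euler_E :: "complex \<Rightarrow> complex" where
  "euler_E q = (\<Prod>n. 1 - q ^ Suc n)"

definition theta_phi :: "complex \<Rightarrow> complex" where
  "theta_phi q = (\<Sum>\<^sub>\<infinity>n\<in>(UNIV :: int set). q powi (n ^ 2))"

definition kronecker_prime :: "int \<Rightarrow> int \<Rightarrow> int" where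
  "kronecker_prime a p =
     (if p = 2
      then (if even a then 0 else if a mod 8 = 1 \<or> a mod 8 = 7 then 1 else -1)
      else Legendre a p)"

(* The Kronecker symbol (a/n), multiplicative in n. The leading sign is the value (a/u) at the
   unit u = sgn n. On the type int, prime_factors yields the positive prime divisors only. *)
definition kronecker :: "int \<Rightarrow> int \<Rightarrow> int" where
  "kronecker a n =
     (if n = 0 then (if \<bar>a\<bar> = 1 then 1 else 0)
      else (if n < 0 \<and> a < 0 then -1 else 1) *
           (\<Prod>p\<in>prime_factors n. kronecker_prime a p ^ multiplicity p n))"

end

theory Submission
  imports Defs
begin

text \<open>
  Write \<open>theta a Q\<close> for the product over \<open>n \<ge> 0\<close> of \<open>(1 - a Q\<^sup>n) (1 - Q\<^sup>n\<^sup>+\<^sup>1 / a)\<close>. Kronecker's formula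
  (a special case of Ramanujan's bilateral summation), obtained here as the limit of a partial
  fraction decomposition, turns each of the four bilateral sums into a single quotient of
  values of \<open>theta\<close> in base \<open>Q = q\<^sup>1\<^sup>0\<close> at the points \<open>\<plusminus>q\<^sup>k\<close>. The two formulas for
  \<open>\<phi>(q) \<phi>(q\<^sup>5)\<close> and the product formula for the Legendre symbol sum then become instances of
  Weierstrass' three-term relation; the product formula for the Kronecker symbol sum follows from
  the even-odd dissection of a product of two theta series. The Kronecker symbol sum plus 1 is the
  sum of the first and third bilateral sums, and the Legendre symbol sum is the fourth minus the
  second, so the last formula for \<open>\<phi>(q) \<phi>(q\<^sup>5)\<close> is the average of the first two.
\<close>

text \<open>Neither analytic continuation nor the theory of elliptic functions enters. The triple
  product and Kronecker's formula are both limits of finite identities, made symmetric by shifting a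
  point by q^(-N); their coefficients are bounded and converge, so dominated convergence applies.
  The base q^10 is dictated by the denominators 1 + q^(10 n + m), which in turn reflect that (-20/n)
  changes sign under n -> n + 10. In this base the reflection k -> 10 - k and the inversion k -> -k
  bring every index into 0..5, and the theorem becomes algebra in the numbers \<open>t 1\<close>,
  ..., \<open>t 5\<close>, \<open>s 0\<close>, ..., \<open>s 5\<close>. The three-term relations are
  homogeneous of degree four in these numbers, whereas the formulas for phi(q) phi(q^5) and for the
  Euler products are not. The gap is closed by Euler's identity (x; x) (-x; x) = (x^2; x^2) at x = q
  and x = q^5, where (a; x) is \<open>qpoch_inf a x\<close>. The constant 1 in the theorem comes
  from the index 0 terms of the first and third bilateral sums, 1/2 each. Negative powers of q occur
  throughout, so q = 0 is treated separately.\<close>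

section \<open>Dominated convergence for infinite sums\<close>

text \<open>The M-test makes the finite partial sums converge uniformly in the parameter, which
  permits exchanging the two limits.\<close>

lemma tendsto_infsum_dominated:
  fixes f :: "'a \<Rightarrow> 'b \<Rightarrow> 'c :: banach"
  assumes lim: "\<And>x. x \<in> A \<Longrightarrow> ((\<lambda>n. f x n) \<longlongrightarrow> g x) F"
    and bound: "\<And>x n. x \<in> A \<Longrightarrow> norm (f x n) \<le> M x"
    and M: "M summable_on A" and F: "F \<noteq> bot"
  shows "((\<lambda>n. \<Sum>\<^sub>\<infinity>x\<in>A. f x n) \<longlongrightarrow> (\<Sum>\<^sub>\<infinity>x\<in>A. g x)) F"
proof (rule swap_uniform_limit')
  have gM: "norm (g x) \<le> M x" if "x \<in> A" for x
    by (rule tendsto_upperbound[OF tendsto_norm[OF lim[OF that]] always_eventually F])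
      (simp add: bound that)
  have "(\<lambda>x. norm (g x)) summable_on A"
    by (rule summable_on_comparison_test[OF M gM norm_ge_zero])
  then have "g summable_on A"
    by (rule abs_summable_summable)
  then show "(sum g \<longlongrightarrow> (\<Sum>\<^sub>\<infinity>x\<in>A. g x)) (finite_subsets_at_top A)"
    by (rule infsum_tendsto)
  show "uniform_limit UNIV (\<lambda>X n. \<Sum>x\<in>X. f x n) (\<lambda>n. \<Sum>\<^sub>\<infinity>x\<in>A. f x n) (finite_subsets_at_top A)"
    by (rule Weierstrass_m_test_general[OF bound M])
  show "\<forall>\<^sub>F X in finite_subsets_at_top A. ((\<lambda>n. \<Sum>x\<in>X. f x n) \<longlongrightarrow> sum g X) F"
  proof (rule eventually_finite_subsets_at_top_weakI)
    show "((\<lambda>n. \<Sum>x\<in>X. f x n) \<longlongrightarrow> sum g X) F" if "X \<subseteq> A" for X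
      by (rule tendsto_sum) (use that lim in blast)
  qed
qed (simp_all add: finite_subsets_at_top_neq_bot)

section \<open>Infinite q-Pochhammer products\<close>

definition qpoch :: "complex \<Rightarrow> complex \<Rightarrow> nat \<Rightarrow> complex" where
  "qpoch a q n = (\<Prod>i<n. 1 - a * q ^ i)"

definition qpoch_inf :: "complex \<Rightarrow> complex \<Rightarrow> complex" where
  "qpoch_inf a q = (\<Prod>i. 1 - a * q ^ i)"

lemma convergent_prod_qpoch_inf:
  fixes a q :: complex
  assumes "norm q < 1"
  shows "convergent_prod (\<lambda>i. 1 - a * q ^ i)"
proof -
  have "summable (\<lambda>i. norm a * norm q ^ i)"
    using assms by (intro summable_mult summable_geometric) auto
  moreover have "norm ((1 - a * q ^ i) - 1) = norm a * norm q ^ i" for i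
    by (simp add: norm_mult norm_power)
  ultimately have "summable (\<lambda>i. norm ((1 - a * q ^ i) - 1))"
    by simp
  then show ?thesis
    by (intro abs_convergent_prod_imp_convergent_prod summable_imp_abs_convergent_prod)
qed

lemma qpoch_tendsto:
  assumes "norm q < 1"
  shows "qpoch a q \<longlonglongrightarrow> qpoch_inf a q"
proof -
  have "(\<lambda>n. \<Prod>i\<le>n. 1 - a * q ^ i) \<longlonglongrightarrow> qpoch_inf a q"
    unfolding qpoch_inf_def by (rule convergent_prod_LIMSEQ[OF convergent_prod_qpoch_inf[OF assms]])
  then have "(\<lambda>n. qpoch a q (Suc n)) \<longlonglongrightarrow> qpoch_inf a q"
    by (simp add: qpoch_def lessThan_Suc_atMost)
  then show ?thesis
    by (simp add: filterlim_sequentially_Suc)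
qed

lemma qpoch_nonzero: "(\<And>i. a * q ^ i \<noteq> 1) \<Longrightarrow> qpoch a q n \<noteq> 0"
  by (auto simp: qpoch_def)

lemma qpoch_inf_nonzero:
  assumes "norm q < 1" "\<And>i. a * q ^ i \<noteq> 1"
  shows "qpoch_inf a q \<noteq> 0"
  unfolding qpoch_inf_def
proof (rule prodinf_nonzero[OF convergent_prod_qpoch_inf[OF assms(1)]])
  show "1 - a * q ^ i \<noteq> 0" for i
    using assms(2)[of i] by simp
qed

lemma mult_power_neq_1:
  fixes a q :: "'a :: real_normed_div_algebra"
  assumes "norm q \<le> 1" "norm a < 1"
  shows "a * q ^ i \<noteq> 1"
proof
  assume "a * q ^ i = 1"
  then have "norm a * norm q ^ i = 1"
    by (metis norm_mult norm_one norm_power)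
  moreover have "norm a * norm q ^ i \<le> norm a"
    using assms by (simp add: mult_left_le power_le_one)
  ultimately show False using assms by simp
qed

lemma qpoch_inf_nonzero': "norm q < 1 \<Longrightarrow> norm a < 1 \<Longrightarrow> qpoch_inf a q \<noteq> 0"
  by (rule qpoch_inf_nonzero, simp) (rule mult_power_neq_1, auto)

lemma qpoch_Suc_shift: "qpoch a q (Suc n) = (1 - a) * qpoch (a * q) q n"
  unfolding qpoch_def by (subst prod.lessThan_Suc_shift) (simp add: mult_ac)

lemma qpoch_inf_Suc:
  assumes "norm q < 1"
  shows "qpoch_inf a q = (1 - a) * qpoch_inf (a * q) q"
proof (rule LIMSEQ_unique)
  show "(\<lambda>n. qpoch a q (Suc n)) \<longlonglongrightarrow> qpoch_inf a q"
    using qpoch_tendsto[OF assms] by (simp add: filterlim_sequentially_Suc)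
  show "(\<lambda>n. qpoch a q (Suc n)) \<longlonglongrightarrow> (1 - a) * qpoch_inf (a * q) q"
    unfolding qpoch_Suc_shift by (intro tendsto_mult_left qpoch_tendsto assms)
qed

lemma qpoch_add: "qpoch a q (m + n) = qpoch a q m * qpoch (a * q ^ m) q n"
  by (induction n) (simp_all add: qpoch_def power_add mult_ac)

text \<open>Sort the factors by their exponent modulo \<open>k\<close>: each residue class is a
  product in base q^k.\<close>

lemma qpoch_dissect: "qpoch a q (k * n) = (\<Prod>i<k. qpoch (a * q ^ i) (q ^ k) n)"
proof (induction n)
  case (Suc n)
  have "qpoch a q (k * Suc n) = qpoch a q (k * n) * qpoch (a * q ^ (k * n)) q k"
    using qpoch_add[of a q "k * n" k] by (simp add: add.commute)
  then show ?case
    by (simp add: Suc) (simp add: qpoch_def prod.distrib power_mult mult_ac)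
qed (simp add: qpoch_def)

lemma qpoch_inf_dissect:
  assumes "norm q < 1" "k > 0"
  shows "qpoch_inf a q = (\<Prod>i<k. qpoch_inf (a * q ^ i) (q ^ k))"
proof (rule LIMSEQ_unique)
  have "strict_mono (\<lambda>n::nat. k * n)"
    using assms by (simp add: strict_mono_def)
  from LIMSEQ_subseq_LIMSEQ[OF qpoch_tendsto[OF assms(1)] this]
  show "(\<lambda>n. qpoch a q (k * n)) \<longlonglongrightarrow> qpoch_inf a q"
    by (simp add: o_def)
  show "(\<lambda>n. qpoch a q (k * n)) \<longlonglongrightarrow> (\<Prod>i<k. qpoch_inf (a * q ^ i) (q ^ k))"
    unfolding qpoch_dissect using assms
    by (intro tendsto_prod qpoch_tendsto) (auto simp: norm_power power_less_one_iff)
qed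

text \<open>Factor by factor this is (1 - b) (1 + b) = 1 - b^2. It yields Euler's identity for a =
  q, and it reduces products in base q^20 to base q^10.\<close>

lemma qpoch_inf_mult_neg:
  assumes "norm q < 1"
  shows "qpoch_inf a q * qpoch_inf (- a) q = qpoch_inf (a ^ 2) (q ^ 2)"
proof (rule LIMSEQ_unique)
  show "(\<lambda>n. qpoch a q n * qpoch (- a) q n) \<longlonglongrightarrow> qpoch_inf a q * qpoch_inf (- a) q"
    by (intro tendsto_mult qpoch_tendsto assms)
  have "qpoch a q n * qpoch (- a) q n = qpoch (a ^ 2) (q ^ 2) n" for n
    by (simp add: qpoch_def flip: prod.distrib)
       (simp add: algebra_simps power2_eq_square power_mult_distrib flip: power_mult)
  then show "(\<lambda>n. qpoch a q n * qpoch (- a) q n) \<longlonglongrightarrow> qpoch_inf (a ^ 2) (q ^ 2)"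
    using assms by (simp add: qpoch_tendsto norm_power power_less_one_iff)
qed

lemma qpoch_bounded:
  assumes "norm q < 1"
  obtains B where "B > 0" "\<And>n. norm (qpoch a q n) \<le> B"
  using convergent_imp_Bseq[OF convergentI[OF qpoch_tendsto[OF assms]]] unfolding Bseq_def by blast

lemma qpoch_inverse_bounded:
  assumes "norm q < 1" "\<And>i. a * q ^ i \<noteq> 1"
  obtains B where "B > 0" "\<And>n. norm (inverse (qpoch a q n)) \<le> B"
proof -
  have "(\<lambda>n. inverse (qpoch a q n)) \<longlonglongrightarrow> inverse (qpoch_inf a q)"
    using assms by (intro tendsto_inverse qpoch_tendsto qpoch_inf_nonzero)
  from convergent_imp_Bseq[OF convergentI[OF this]] show ?thesis
    unfolding Bseq_def using that by blast
qed

lemma euler_E_eq_qpoch_inf: "euler_E q = qpoch_inf q q"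
  by (simp add: euler_E_def qpoch_inf_def)

section \<open>The theta product and its symmetries\<close>

definition theta :: "complex \<Rightarrow> complex \<Rightarrow> complex" where
  "theta a q = qpoch_inf a q * qpoch_inf (q / a) q"

lemma theta_reflect: "q \<noteq> 0 \<Longrightarrow> theta (q / a) q = theta a q"
  by (cases "a = 0") (auto simp: theta_def)

text \<open>The shift removes the factor 1 - a from one product and adds 1 - 1/a to the other; their
  ratio is -1/a.\<close>

lemma theta_shift:
  assumes "norm q < 1" "q \<noteq> 0" "a \<noteq> 0"
  shows "theta (q * a) q = - theta a q / a"
proof -
  have "theta (q * a) q = qpoch_inf (a * q) q * qpoch_inf (1 / a) q"
    using assms by (simp add: theta_def mult.commute)
  also have "qpoch_inf (1 / a) q = (1 - 1 / a) * qpoch_inf (q / a) q"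
    using qpoch_inf_Suc[OF assms(1), of "1 / a"] by simp
  also have "qpoch_inf (a * q) q * ((1 - 1 / a) * qpoch_inf (q / a) q) = - theta a q / a"
    using assms by (simp add: theta_def qpoch_inf_Suc[OF assms(1), of a] field_simps)
  finally show ?thesis .
qed

lemma theta_inverse:
  assumes "norm q < 1" "q \<noteq> 0" "a \<noteq> 0"
  shows "theta (1 / a) q = - theta a q / a"
  using theta_shift[OF assms] theta_reflect[OF assms(2), of "1 / a"] by simp

lemma theta_nonzero:
  assumes "norm q < 1" "q \<noteq> 0" "a \<noteq> 0" "\<And>i::int. a * q powi i \<noteq> 1"
  shows "theta a q \<noteq> 0"
proof -
  have "a * q ^ i \<noteq> 1" for i using assms(4)[of "int i"] by simp
  moreover have "q / a * q ^ i \<noteq> 1" for i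
  proof
    assume "q / a * q ^ i = 1"
    \<comment> \<open>The second product vanishes at the positive powers of q: its factor number
      \<open>i\<close> is 0 at a = q^(i + 1).\<close>
    then have "a * q powi (- int (Suc i)) = 1"
      using assms(2,3) by (simp only: power_int_minus power_int_of_nat) (simp add: field_simps)
    then show False using assms(4) by blast
  qed
  ultimately show ?thesis
    using qpoch_inf_nonzero[OF assms(1)] by (simp add: theta_def)
qed

section \<open>The Jacobi triple product\<close>

lemma summable_on_int_norm:
  fixes f :: "int \<Rightarrow> 'a :: banach"
  assumes "summable (\<lambda>n. norm (f (int n)))" "summable (\<lambda>n. norm (f (- int n)))"
  shows "(\<lambda>n. norm (f n)) summable_on UNIV"
proof -
  have *: "(\<lambda>n. norm (f (int n))) summable_on UNIV" "(\<lambda>n. norm (f (- int n))) summable_on UNIV"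
    using assms by (auto intro!: norm_summable_imp_summable_on)
  have 1: "(\<lambda>n. norm (f n)) summable_on range int"
    by (subst summable_on_reindex) (use * in \<open>auto simp: o_def inj_on_def\<close>)
  have 2: "(\<lambda>n. norm (f n)) summable_on range (\<lambda>n. - int n)"
    by (subst summable_on_reindex) (use * in \<open>auto simp: o_def inj_on_def\<close>)
  have "n \<in> range int \<union> range (\<lambda>n. - int n)" for n
    by (cases n rule: int_cases2) auto
  then have "range int \<union> range (\<lambda>n. - int n) = UNIV"
    by blast
  with summable_on_union[OF 1 2] show ?thesis
    by simp
qed

abbreviation tri :: "int \<Rightarrow> int" where "tri n \<equiv> n * (n - 1) div 2"

lemma tri_double: "2 * tri n = n * (n - 1)"
  by (rule dvd_mult_div_cancel) simp

lemma tri_add: "tri (m + n) = tri m + tri n + m * n"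
proof -
  have "2 * tri (m + n) = 2 * (tri m + tri n + m * n)"
    unfolding distrib_left tri_double by (simp add: algebra_simps)
  then show ?thesis
    by (rule mult_left_cancel[THEN iffD1, rotated]) simp
qed

definition theta_term :: "complex \<Rightarrow> complex \<Rightarrow> int \<Rightarrow> complex" where
  "theta_term z q n = (-1) powi n * q powi tri n * z powi n"

text \<open>Since \<open>tri\<close> is quadratic, the terms multiply up to the cross term q^(m n).
  The ratio test, the reversal of Pochhammer products and the centring of sums all rest on this
  rule.\<close>

lemma theta_term_add:
  assumes "q \<noteq> 0" "z \<noteq> 0"
  shows "theta_term z q (m + n) = theta_term z q m * theta_term z q n * q powi (m * n)"
  using assms unfolding theta_term_def tri_add by (simp add: power_int_add)

lemma theta_term_0 [simp]: "theta_term z q 0 = 1"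
  by (simp add: theta_term_def)

lemma theta_term_summable:
  assumes "norm q < 1" "q \<noteq> 0" "z \<noteq> 0"
  shows "(\<lambda>n. norm (theta_term z q n)) summable_on UNIV"
proof (rule summable_on_int_norm)
  \<comment> \<open>One ratio test serves both directions: as s * s = 1, the step from s n to s (n +
    1) multiplies the norm by a constant times \<open>norm q ^ n\<close> either way.\<close>
  have *: "summable (\<lambda>n. norm (theta_term z q (s * int n)))" if s: "s = 1 \<or> s = -1" for s
  proof -
    define r where "r = norm (theta_term z q s)"
    have "(\<lambda>n. r * norm q ^ n) \<longlonglongrightarrow> r * 0"
      by (intro tendsto_intros) (use assms in auto)
    then have "eventually (\<lambda>n. r * norm q ^ n < 1/2) sequentially"
      by (rule order_tendstoD) auto
    then obtain N where N: "\<And>n. n \<ge> N \<Longrightarrow> r * norm q ^ n < 1/2"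
      by (auto simp: eventually_sequentially)
    have step: "norm (theta_term z q (s * int (Suc n))) = r * norm q ^ n * norm (theta_term z q (s * int n))" for n
    proof -
      have "theta_term z q (s * int (Suc n)) = theta_term z q s * theta_term z q (s * int n) * q powi (s * (s * int n))"
        using theta_term_add[OF assms(2,3), of s "s * int n"] by (simp add: algebra_simps)
      moreover have "s * (s * int n) = int n"
        using s by auto
      ultimately show ?thesis
        by (simp add: r_def norm_mult norm_power)
    qed
    show ?thesis
    proof (rule summable_ratio_test[of "1/2" N])
      show "norm (norm (theta_term z q (s * int (Suc n)))) \<le> 1/2 * norm (norm (theta_term z q (s * int n)))" if "n \<ge> N" for n
        using mult_right_mono[of "r * norm q ^ n" "1/2" "norm (theta_term z q (s * int n))"] N[OF that]
        unfolding real_norm_def abs_norm_cancel step[symmetric] by simp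
    qed simp
  qed
  from *[of 1] *[of "-1"] show "summable (\<lambda>n. norm (theta_term z q (int n)))" "summable (\<lambda>n. norm (theta_term z q (- int n)))"
    by simp_all
qed

definition theta_series :: "complex \<Rightarrow> complex \<Rightarrow> complex" where
  "theta_series z q = (\<Sum>\<^sub>\<infinity>n. theta_term z q n)"

section \<open>Gaussian binomials and the finite triple product\<close>

definition qbin :: "complex \<Rightarrow> nat \<Rightarrow> nat \<Rightarrow> complex" where
  "qbin q n k = qpoch q q n / (qpoch q q k * qpoch q q (n - k))"

text \<open>The q-Pascal rule. Over a common denominator it reads 1 - q^(n+1) = (1 - q^(m+1)) +
  q^(m+1) (1 - q^(j+1)) with n = j + m + 1.\<close>

lemma qbin_rec:
  assumes "norm q < 1" "0 < k" "k \<le> n"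
  shows "qbin q (Suc n) k = qbin q n k + q ^ (Suc n - k) * qbin q n (k - 1)"
proof -
  obtain j where k: "k = Suc j" using assms(2) by (cases k) auto
  obtain m where n: "n = k + m" using assms(3) le_Suc_ex by blast
  have nz: "qpoch q q i \<noteq> 0" for i
    by (rule qpoch_nonzero, rule mult_power_neq_1) (use assms in auto)
  have nz': "1 - q * q ^ i \<noteq> 0" for i
    using mult_power_neq_1[of q q i] assms by auto
  have S: "qpoch q q (Suc i) = qpoch q q i * (1 - q * q ^ i)" for i
    by (simp add: qpoch_def)
  have "qbin q (Suc n) k = qpoch q q n * (1 - q * q ^ n) / (qpoch q q j * (1 - q * q ^ j) * (qpoch q q m * (1 - q * q ^ m)))"
    by (simp add: qbin_def n k S Suc_diff_le)
  moreover have "qbin q n k = qpoch q q n * (1 - q * q ^ m) / (qpoch q q j * (1 - q * q ^ j) * (qpoch q q m * (1 - q * q ^ m)))"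
    using nz nz' by (simp add: qbin_def n k S)
  moreover have "qbin q n (k - 1) = qpoch q q n * (1 - q * q ^ j) / (qpoch q q j * (1 - q * q ^ j) * (qpoch q q m * (1 - q * q ^ m)))"
    using nz nz' by (simp add: qbin_def n k S)
  moreover have "1 - q * q ^ n = (1 - q * q ^ m) + q ^ (Suc n - k) * (1 - q * q ^ j)"
    by (simp add: n k algebra_simps power_add)
  ultimately show ?thesis
    by (simp add: add_divide_distrib[symmetric] algebra_simps)
qed

lemma qbin_0 [simp]: "norm q < 1 \<Longrightarrow> qbin q n 0 = 1" "norm q < 1 \<Longrightarrow> qbin q n n = 1"
proof -
  assume "norm q < 1"
  then have "qpoch q q i \<noteq> 0" for i
    by (intro qpoch_nonzero mult_power_neq_1) auto
  then show "qbin q n 0 = 1" "qbin q n n = 1"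
    by (auto simp: qbin_def) (simp_all add: qpoch_def)
qed

lemma q_binomial:
  assumes "norm q < 1"
  shows "qpoch x q n = (\<Sum>k\<le>n. (-1) ^ k * q ^ (k * (k - 1) div 2) * qbin q n k * x ^ k)"
proof (induction n)
  case 0
  show ?case using assms by (simp add: qpoch_def)
next
  case (Suc n)
  define c where "c k = (-1) ^ k * q ^ (k * (k - 1) div 2)" for k
  have c_Suc: "c (Suc k) = - c k * q ^ k" for k
  proof -
    have "Suc k * k div 2 = k * (k - 1) div 2 + k"
      by (cases k) (auto simp: algebra_simps)
    then show ?thesis by (simp add: c_def power_add)
  qed
  \<comment> \<open>Both end terms are split off since \<open>qbin_rec\<close> needs 0 < k <= n.
    Truncated subtraction makes \<open>qbin q n (Suc n)\<close> nonzero, so the rule cannot be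
    stretched to the upper end.\<close>
  have "(\<Sum>k<Suc (Suc n). c k * qbin q (Suc n) k * x ^ k) =
      c 0 * x ^ 0 + (\<Sum>k<n. c (Suc k) * qbin q (Suc n) (Suc k) * x ^ Suc k) + c (Suc n) * x ^ Suc n"
    unfolding sum.lessThan_Suc_shift[of _ "Suc n"] unfolding sum.lessThan_Suc
    using assms by simp
  also have "(\<Sum>k<n. c (Suc k) * qbin q (Suc n) (Suc k) * x ^ Suc k) =
      (\<Sum>k<n. c (Suc k) * qbin q n (Suc k) * x ^ Suc k) - x * q ^ n * (\<Sum>k<n. c k * qbin q n k * x ^ k)"
    unfolding sum_distrib_left sum_subtractf[symmetric]
  proof (rule sum.cong)
    fix k assume k: "k \<in> {..<n}"
    \<comment> \<open>Hence the power of q in the second Pascal summand does not depend on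
      \<open>k\<close>, and x q^n comes out of the sum; this produces the new factor 1 - x
      q^n.\<close>
    have "q ^ k * q ^ (n - k) = q ^ n"
      using k by (simp flip: power_add)
    then show "c (Suc k) * qbin q (Suc n) (Suc k) * x ^ Suc k =
        c (Suc k) * qbin q n (Suc k) * x ^ Suc k - x * q ^ n * (c k * qbin q n k * x ^ k)"
      using k assms by (simp add: qbin_rec c_Suc algebra_simps)
  qed simp
  also have "c 0 * x ^ 0 + ((\<Sum>k<n. c (Suc k) * qbin q n (Suc k) * x ^ Suc k) - x * q ^ n * (\<Sum>k<n. c k * qbin q n k * x ^ k)) + c (Suc n) * x ^ Suc n
    = (1 - x * q ^ n) * (\<Sum>k<Suc n. c k * qbin q n k * x ^ k)"
  proof -
    have "(\<Sum>k<Suc n. c k * qbin q n k * x ^ k) = c 0 * x ^ 0 + (\<Sum>k<n. c (Suc k) * qbin q n (Suc k) * x ^ Suc k)"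
      unfolding sum.lessThan_Suc_shift using assms by simp
    moreover have "(\<Sum>k<Suc n. c k * qbin q n k * x ^ k) = (\<Sum>k<n. c k * qbin q n k * x ^ k) + c n * x ^ n"
      unfolding sum.lessThan_Suc using assms by simp
    moreover have "c0 + (A - y * B) + c1 = (1 - y) * P" if "P = c0 + A" "P = B + cn" "c1 = - y * cn"
      for c0 c1 cn A B P y :: complex
    proof -
      have "c0 + (A - y * B) + c1 = (c0 + A) - y * (B + cn)"
        unfolding that(3) by (simp add: algebra_simps)
      also have "\<dots> = (1 - y) * P"
        unfolding that(1)[symmetric] that(2)[symmetric] by (simp add: algebra_simps)
      finally show ?thesis .
    qed
    moreover have "c (Suc n) * x ^ Suc n = - (x * q ^ n) * (c n * x ^ n)"
      by (simp add: c_Suc)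
    ultimately show ?thesis
      by blast
  qed
  also have "(\<Sum>k<Suc n. c k * qbin q n k * x ^ k) = qpoch x q n"
    unfolding Suc c_def lessThan_Suc_atMost by simp
  finally show ?case
    unfolding c_def lessThan_Suc_atMost by (simp add: qpoch_def mult_ac)
qed

lemma powi_minus_mult_power: "q \<noteq> 0 \<Longrightarrow> q powi (- int N) * q ^ N = 1" for q :: complex
  by (simp add: power_int_minus)

text \<open>Reverse the factors and pull -z q^(-j) out of each, for j = 1, ..., N. The resulting
  monomial (-z)^N q^(-N (N+1)/2) is expressed by \<open>theta_term\<close> so that
  \<open>theta_term_add\<close> can act on it.\<close>

lemma qpoch_negative_shift:
  assumes "q \<noteq> 0" "z \<noteq> 0"
  shows "qpoch (z * q powi (- int N)) q N = theta_term z q (int N) * q powi (- (int N * int N)) * qpoch (q / z) q N"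
proof (induction N)
  case 0
  show ?case by (simp add: qpoch_def)
next
  case (Suc N)
  have 1: "q powi (- int (Suc N)) * q = q powi (- int N)"
    using assms power_int_add_1[of q "- int (Suc N)"] by simp
  have 2: "1 - z * q powi (- int (Suc N)) = - z * q powi (- int (Suc N)) * (1 - q / z * q ^ N)"
  proof -
    have "q powi (- int (Suc N)) * q ^ Suc N = 1"
      by (rule powi_minus_mult_power[OF assms(1)])
    then show ?thesis
      using assms by (simp add: algebra_simps)
  qed
  have 3: "theta_term z q (int (Suc N)) = - z * theta_term z q (int N) * q powi int N"
    using theta_term_add[OF assms, of "int N" 1] by (simp add: theta_term_def algebra_simps)
  have 4: "q powi (int N) * q powi (- (int (Suc N) * int (Suc N))) = q powi (- int (Suc N)) * q powi (- (int N * int N))"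
    unfolding power_int_add[OF disjI1[OF assms(1)], symmetric] by (simp add: algebra_simps)
  have "qpoch (z * q powi (- int (Suc N))) q (Suc N) =
      (1 - z * q powi (- int (Suc N))) * qpoch (z * q powi (- int N)) q N"
    unfolding qpoch_Suc_shift mult.assoc 1 ..
  also have "\<dots> = - z * (q powi (- int (Suc N)) * q powi (- (int N * int N))) * theta_term z q (int N) * (qpoch (q / z) q N * (1 - q / z * q ^ N))"
    unfolding Suc 2 by (simp only: mult_ac)
  also have "\<dots> = theta_term z q (int (Suc N)) * q powi (- (int (Suc N) * int (Suc N))) * qpoch (q / z) q (Suc N)"
    unfolding 3 4[symmetric] by (simp only: qpoch_def prod.lessThan_Suc mult_ac)
  finally show ?case .
qed

lemma theta_term_of_nat: "theta_term z q (int k) = (-1) ^ k * q ^ (k * (k - 1) div 2) * z ^ k"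
proof -
  have "tri (int k) = int (k * (k - 1) div 2)"
    by (cases k) (simp_all add: zdiv_int algebra_simps)
  then show ?thesis
    by (simp only: theta_term_def power_int_of_nat)
qed

text \<open>The q-binomial theorem is applied to 2 N factors starting at z q^(-N). The first N of
  them reverse into the second product, the others are the first product, and the index k = N + m
  runs symmetrically; the monomial \<open>C\<close> is common to both sides.\<close>

lemma jacobi_triple_finite:
  assumes "norm q < 1" "q \<noteq> 0" "z \<noteq> 0"
  shows "qpoch z q N * qpoch (q / z) q N =
    (\<Sum>m\<in>{- int N..int N}. qbin q (2 * N) (nat (int N + m)) * theta_term z q m)"
proof -
  define C where "C = theta_term z q (int N) * q powi (- (int N * int N))"
  have C: "C \<noteq> 0"
    using assms by (simp add: C_def theta_term_def)
  have "C * (qpoch z q N * qpoch (q / z) q N) = qpoch (z * q powi (- int N)) q (2 * N)"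
    unfolding mult_2 qpoch_add qpoch_negative_shift[OF assms(2,3)] C_def mult.assoc
      powi_minus_mult_power[OF assms(2)] by (simp add: mult_ac)
  also have "\<dots> = (\<Sum>k\<le>2 * N. qbin q (2 * N) k * (theta_term z q (int k) * q powi (- (int N * int k))))"
  proof -
    have "(z * q powi (- int N)) ^ k = z ^ k * q powi (- (int N * int k))" for k
      unfolding power_mult_distrib minus_mult_left power_int_mult power_int_of_nat ..
    then show ?thesis
      unfolding q_binomial[OF assms(1)] theta_term_of_nat by (intro sum.cong) (simp_all only: mult_ac)
  qed
  also have "\<dots> = (\<Sum>k\<le>2 * N. qbin q (2 * N) k * (C * theta_term z q (int k - int N)))"
  proof (rule sum.cong)
    fix k
    have "theta_term z q (int k) * q powi (- (int N * int k)) =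
      theta_term z q (int N) * theta_term z q (int k - int N) * (q powi (int N * (int k - int N)) * q powi (- (int N * int k)))"
      using theta_term_add[OF assms(2,3), of "int N" "int k - int N"] by simp
    also have "q powi (int N * (int k - int N)) * q powi (- (int N * int k)) = q powi (- (int N * int N))"
      unfolding power_int_add[OF disjI1[OF assms(2)], symmetric] by (simp add: algebra_simps)
    finally show "qbin q (2 * N) k * (theta_term z q (int k) * q powi (- (int N * int k))) =
        qbin q (2 * N) k * (C * theta_term z q (int k - int N))"
      by (simp add: C_def)
  qed simp
  also have "\<dots> = C * (\<Sum>k\<le>2 * N. qbin q (2 * N) k * theta_term z q (int k - int N))"
    by (simp add: sum_distrib_left mult_ac)
  also have "(\<Sum>k\<le>2 * N. qbin q (2 * N) k * theta_term z q (int k - int N)) =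
      (\<Sum>m\<in>{- int N..int N}. qbin q (2 * N) (nat (int N + m)) * theta_term z q m)"
    by (rule sum.reindex_bij_witness[of _ "\<lambda>m. nat (int N + m)" "\<lambda>k. int k - int N"]) auto
  finally show ?thesis
    using C by simp
qed

lemma filterlim_nat_int_add: "filterlim (\<lambda>N. nat (int N + m)) sequentially sequentially"
  unfolding filterlim_at_top
proof
  fix Z :: nat
  show "\<forall>\<^sub>F N in sequentially. Z \<le> nat (int N + m)"
    using eventually_ge_at_top[of "Z + nat \<bar>m\<bar>"] by eventually_elim linarith
qed

text \<open>A bound on the weights is asked only inside the window, because outside it
  \<open>nat\<close> truncates their indices. There the weight is replaced by 0 before dominated
  convergence is used.\<close>

lemma tendsto_infsum_symmetric:
  fixes c :: "int \<Rightarrow> nat \<Rightarrow> complex" and f :: "int \<Rightarrow> complex"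
  assumes f: "(\<lambda>m. norm (f m)) summable_on UNIV"
    and c: "\<And>m. c m \<longlonglongrightarrow> d" and bound: "\<And>m N. \<bar>m\<bar> \<le> int N \<Longrightarrow> norm (c m N) \<le> B"
  shows "(\<lambda>N. \<Sum>m\<in>{- int N..int N}. c m N * f m) \<longlonglongrightarrow> d * (\<Sum>\<^sub>\<infinity>m. f m)"
proof -
  have "(\<lambda>N. \<Sum>\<^sub>\<infinity>m. (if \<bar>m\<bar> \<le> int N then c m N else 0) * f m) \<longlonglongrightarrow> (\<Sum>\<^sub>\<infinity>m. d * f m)"
  proof (rule tendsto_infsum_dominated)
    show "(\<lambda>m. \<bar>B\<bar> * norm (f m)) summable_on UNIV"
      by (rule summable_on_cmult_right[OF f])
    fix m :: int
    have "\<forall>\<^sub>F N in sequentially. c m N * f m = (if \<bar>m\<bar> \<le> int N then c m N else 0) * f m"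
      using eventually_ge_at_top[of "nat \<bar>m\<bar>"] by eventually_elim auto
    moreover have "(\<lambda>N. c m N * f m) \<longlonglongrightarrow> d * f m"
      by (intro tendsto_mult_right c)
    ultimately show "(\<lambda>N. (if \<bar>m\<bar> \<le> int N then c m N else 0) * f m) \<longlonglongrightarrow> d * f m"
      by (rule Lim_transform_eventually[rotated])
    show "norm ((if \<bar>m\<bar> \<le> int N then c m N else 0) * f m) \<le> \<bar>B\<bar> * norm (f m)" for N
      unfolding norm_mult using bound[of m N] by (intro mult_right_mono) auto
  qed simp
  also have "(\<lambda>N. \<Sum>\<^sub>\<infinity>m. (if \<bar>m\<bar> \<le> int N then c m N else 0) * f m) =
      (\<lambda>N. \<Sum>m\<in>{- int N..int N}. c m N * f m)"
  proof
    fix N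
    have "(\<Sum>\<^sub>\<infinity>m. (if \<bar>m\<bar> \<le> int N then c m N else 0) * f m) =
        (\<Sum>\<^sub>\<infinity>m\<in>{- int N..int N}. c m N * f m)"
      by (rule infsum_cong_neutral) auto
    then show "(\<Sum>\<^sub>\<infinity>m. (if \<bar>m\<bar> \<le> int N then c m N else 0) * f m) = (\<Sum>m\<in>{- int N..int N}. c m N * f m)"
      by simp
  qed
  also have "(\<Sum>\<^sub>\<infinity>m. d * f m) = d * (\<Sum>\<^sub>\<infinity>m. f m)"
    by (rule infsum_cmult_right')
  finally show ?thesis .
qed

theorem jacobi_triple_product:
  assumes "norm q < 1" "q \<noteq> 0" "z \<noteq> 0"
  shows "theta_series z q = qpoch_inf q q * theta z q"
proof -
  have nz: "qpoch_inf q q \<noteq> 0"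
    using assms by (intro qpoch_inf_nonzero')
  obtain B where B: "B > 0" "\<And>n. norm (qpoch q q n) \<le> B"
    using qpoch_bounded[OF assms(1)] by blast
  have ne1: "q * q ^ i \<noteq> 1" for i
    by (rule mult_power_neq_1) (use assms in auto)
  obtain B' where B': "B' > 0" "\<And>n. norm (inverse (qpoch q q n)) \<le> B'"
    using qpoch_inverse_bounded[OF assms(1) ne1] by blast
  have "(\<lambda>N. \<Sum>m\<in>{- int N..int N}. qbin q (2 * N) (nat (int N + m)) * theta_term z q m)
      \<longlonglongrightarrow> inverse (qpoch_inf q q) * (\<Sum>\<^sub>\<infinity>m. theta_term z q m)"
  proof (rule tendsto_infsum_symmetric[OF theta_term_summable[OF assms]])
    fix m :: int
    have eq: "2 * N - nat (int N + m) = nat (int N + (- m))" if "\<bar>m\<bar> \<le> int N" for N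
      using that by linarith
    have "(\<lambda>N. qpoch q q (2 * N) / (qpoch q q (nat (int N + m)) * qpoch q q (nat (int N + (- m)))))
        \<longlonglongrightarrow> qpoch_inf q q / (qpoch_inf q q * qpoch_inf q q)"
      using nz
      by (intro tendsto_intros filterlim_compose[OF qpoch_tendsto[OF assms(1)]] filterlim_nat_int_add
          mult_nat_left_at_top) auto
    moreover have "\<forall>\<^sub>F N in sequentially. qpoch q q (2 * N) / (qpoch q q (nat (int N + m)) * qpoch q q (nat (int N + (- m)))) =
        qbin q (2 * N) (nat (int N + m))"
      using eventually_ge_at_top[of "nat \<bar>m\<bar>"]
    proof eventually_elim
      case (elim N)
      then have "\<bar>m\<bar> \<le> int N" by linarith
      then show ?case by (simp only: qbin_def eq)
    qed
    ultimately show "(\<lambda>N. qbin q (2 * N) (nat (int N + m))) \<longlonglongrightarrow> inverse (qpoch_inf q q)"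
      using nz by (auto intro: Lim_transform_eventually simp: field_simps)
    show "norm (qbin q (2 * N) (nat (int N + m))) \<le> B * (B' * B')" if "\<bar>m\<bar> \<le> int N" for N
      unfolding qbin_def divide_inverse norm_mult inverse_mult_distrib
      by (intro mult_mono B B') (use B B' in auto)
  qed
  then have "(\<lambda>N. qpoch z q N * qpoch (q / z) q N) \<longlonglongrightarrow> inverse (qpoch_inf q q) * theta_series z q"
    by (simp only: jacobi_triple_finite[OF assms] theta_series_def)
  moreover have "(\<lambda>N. qpoch z q N * qpoch (q / z) q N) \<longlonglongrightarrow> theta z q"
    unfolding theta_def by (intro tendsto_mult qpoch_tendsto assms)
  ultimately have "inverse (qpoch_inf q q) * theta_series z q = theta z q"
    by (rule LIMSEQ_unique)
  then show ?thesis
    using nz by (simp add: field_simps)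
qed

section \<open>Kronecker's bilateral sum\<close>

text \<open>With M factors above and M + 1 distinct poles below there is no polynomial part. After
  clearing denominators both sides are polynomials in \<open>y\<close> of degree at most M that
  agree at the M + 1 points 1 / x k.\<close>

lemma partial_fractions:
  fixes c :: "nat \<Rightarrow> complex" and x :: "nat \<Rightarrow> complex"
  assumes inj: "inj_on x {..M}" and nz: "\<And>k. k \<le> M \<Longrightarrow> x k \<noteq> 0"
    and y: "\<And>k. k \<le> M \<Longrightarrow> 1 - y * x k \<noteq> 0"
  shows "(\<Prod>i<M. 1 - y * c i) / (\<Prod>i\<le>M. 1 - y * x i) =
    (\<Sum>k\<le>M. (\<Prod>i<M. 1 - c i / x k) / (\<Prod>i\<in>{..M} - {k}. 1 - x i / x k) / (1 - y * x k))"
proof -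
  define w where "w k = (\<Prod>i<M. 1 - c i / x k) / (\<Prod>i\<in>{..M} - {k}. 1 - x i / x k)" for k
  define p where "p = (\<Prod>i<M. [:1, - c i:])"
  define r where "r = (\<Sum>k\<le>M. Polynomial.smult (w k) (\<Prod>i\<in>{..M} - {k}. [:1, - x i:]))"
  have deg: "degree (\<Prod>i\<in>A. [:1, - d i:]) \<le> card A" if "finite A" for d :: "nat \<Rightarrow> complex" and A
  proof -
    have "degree (\<Prod>i\<in>A. [:1, - d i:]) \<le> (\<Sum>i\<in>A. degree [:1, - d i:])"
      using degree_prod_sum_le[OF that, of "\<lambda>i. [:1, - d i:]"] by (simp only: o_def)
    also have "\<dots> \<le> (\<Sum>i\<in>A. 1)"
      by (rule sum_mono) simp
    finally show ?thesis by simp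
  qed
  have "degree p \<le> M"
    using deg[of "{..<M}" c] by (simp add: p_def)
  have "degree r \<le> M"
    unfolding r_def
  proof (rule degree_sum_le)
    fix k assume "k \<in> {..M}"
    then have "card ({..M} - {k}) \<le> M" by simp
    then show "degree (Polynomial.smult (w k) (\<Prod>i\<in>{..M} - {k}. [:1, - x i:])) \<le> M"
      using deg[of "{..M} - {k}" x, OF finite_Diff[OF finite_atMost]] degree_smult_le[of "w k" "\<Prod>i\<in>{..M} - {k}. [:1, - x i:]"] by linarith
  qed simp
  have eval_r: "poly r t = (\<Sum>k\<le>M. w k * (\<Prod>i\<in>{..M} - {k}. 1 - t * x i))" for t
    by (simp add: r_def poly_sum poly_prod)
  have eval_p: "poly p t = (\<Prod>i<M. 1 - t * c i)" for t
    by (simp add: p_def poly_prod)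
  have "p = r"
  proof (rule poly_eqI_degree)
    have "card ((\<lambda>k. 1 / x k) ` {..M}) = Suc M"
      by (subst card_image) (use inj nz in \<open>auto simp: inj_on_def\<close>)
    then show "degree p < card ((\<lambda>k. 1 / x k) ` {..M})" "degree r < card ((\<lambda>k. 1 / x k) ` {..M})"
      using \<open>degree p \<le> M\<close> \<open>degree r \<le> M\<close> by simp_all
    fix t assume "t \<in> (\<lambda>k. 1 / x k) ` {..M}"
    then obtain k where k: "k \<le> M" and t: "t = 1 / x k" by auto
    \<comment> \<open>At 1 / x k every summand except the one for \<open>k\<close> contains a
      vanishing factor.\<close>
    have "(\<Prod>i\<in>{..M} - {j}. 1 - t * x i) = 0" if "j \<le> M" "j \<noteq> k" for j
      by (rule prod_zero[OF _ bexI[of _ k]]) (use that k t nz in auto)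
    then have "poly r t = (\<Sum>j\<le>M. if j = k then w k * (\<Prod>i\<in>{..M} - {k}. 1 - t * x i) else 0)"
      unfolding eval_r by (intro sum.cong) auto
    also have "\<dots> = w k * (\<Prod>i\<in>{..M} - {k}. 1 - t * x i)"
      using k by simp
    also have "(\<Prod>i\<in>{..M} - {k}. 1 - t * x i) \<noteq> 0"
      using k t nz inj by (auto simp: inj_on_def)
    then have "w k * (\<Prod>i\<in>{..M} - {k}. 1 - t * x i) = (\<Prod>i<M. 1 - t * c i)"
      by (simp add: w_def t)
    finally show "poly p t = poly r t"
      by (simp add: eval_p)
  qed
  have nzp: "(\<Prod>i\<le>M. 1 - y * x i) \<noteq> 0"
    using y by simp
  have "w k / (1 - y * x k) * (\<Prod>i\<le>M. 1 - y * x i) = w k * (\<Prod>i\<in>{..M} - {k}. 1 - y * x i)" if "k \<le> M" for k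
    using y[OF that] that by (subst prod.remove[of "{..M}" k]) auto
  then have "(\<Sum>k\<le>M. w k / (1 - y * x k)) * (\<Prod>i\<le>M. 1 - y * x i) = poly r y"
    unfolding eval_r sum_distrib_right by (intro sum.cong) auto
  also have "\<dots> = (\<Prod>i<M. 1 - y * c i)"
    using \<open>p = r\<close> eval_p by simp
  finally have "(\<Sum>k\<le>M. w k / (1 - y * x k)) = (\<Prod>i<M. 1 - y * c i) / (\<Prod>i\<le>M. 1 - y * x i)"
    using nzp by (simp add: eq_divide_eq)
  then show ?thesis
    by (simp add: w_def)
qed

lemma theta_term_mult_right: "theta_term (a * z) q n = theta_term a q n * z powi n"
  by (simp add: theta_term_def power_int_mult_distrib mult_ac)

text \<open>The numerator at the pole y = q^(-m), with n poles after it and without its factor z^m.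
  As m and n grow it tends to theta z q / (q; q)^2 regardless of the index, so the limit is a
  bilateral series without weights.\<close>

definition kronecker_coeff :: "complex \<Rightarrow> complex \<Rightarrow> nat \<Rightarrow> nat \<Rightarrow> complex" where
  "kronecker_coeff z q m n = qpoch (q / z) q m * qpoch z q n / (qpoch q q m * qpoch q q n)"

lemma kronecker_finite_aux:
  assumes "norm q < 1" "q \<noteq> 0" "z \<noteq> 0" and y: "\<And>k. 1 - y * q ^ k \<noteq> 0"
  shows "qpoch (y * z) q M / qpoch y q (Suc M) = (\<Sum>k\<le>M. kronecker_coeff z q k (M - k) * (z ^ k / (1 - y * q ^ k)))"
proof -
  have nz: "qpoch q q k \<noteq> 0" for k
    by (rule qpoch_nonzero, rule mult_power_neq_1) (use assms in auto)
  have inj: "inj_on (\<lambda>k. q ^ k) {..M}"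
  proof (rule inj_onI)
    have *: "i \<ge> j" if "q ^ i = q ^ j" for i j :: nat
    proof (rule ccontr)
      assume "\<not> i \<ge> j"
      then have "q ^ j = q ^ i * q ^ (j - i)"
        by (simp flip: power_add)
      with that assms have "q ^ (j - i) = 1" by simp
      then have "norm q ^ (j - i) = 1" by (metis norm_one norm_power)
      moreover have "norm q ^ (j - i) < 1"
        using assms \<open>\<not> i \<ge> j\<close> by (simp add: power_less_one_iff)
      ultimately show False by simp
    qed
    show "i = j" if "q ^ i = q ^ j" for i j
      using *[of i j] *[of j i] that by simp
  qed
  have coef: "(\<Prod>i<M. 1 - z * q ^ i / q ^ k) / (\<Prod>i\<in>{..M} - {k}. 1 - q ^ i / q ^ k) = kronecker_coeff z q k (M - k) * z ^ k"
    if k: "k \<le> M" for k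
  proof -
    \<comment> \<open>The factors of index below \<open>k\<close> carry negative exponents.
      Reversing them gives the monomial \<open>C\<close> in numerator and denominator alike, apart
      from z^k.\<close>
    define C where "C = theta_term 1 q (int k) * q powi (- (int k * int k))"
    have C: "C \<noteq> 0"
      using assms by (simp add: C_def theta_term_def)
    have M: "k + (M - k) = M" using k by simp
    have "(\<Prod>i<M. 1 - z * q ^ i / q ^ k) = qpoch (z * q powi (- int k)) q (k + (M - k))"
      unfolding M qpoch_def by (simp add: power_int_minus divide_inverse mult_ac)
    also have "\<dots> = C * z ^ k * qpoch (q / z) q k * qpoch z q (M - k)"
      unfolding qpoch_add qpoch_negative_shift[OF assms(2,3)] C_def mult.assoc
        powi_minus_mult_power[OF assms(2)] using theta_term_mult_right[of 1 z q "int k"] by (simp add: mult_ac)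
    finally have num: "(\<Prod>i<M. 1 - z * q ^ i / q ^ k) = C * z ^ k * qpoch (q / z) q k * qpoch z q (M - k)" .
    have split: "{..M} - {k} = {..<k} \<union> {k<..M}"
      using k by auto
    have "(\<Prod>i\<in>{..M} - {k}. 1 - q ^ i / q ^ k) = (\<Prod>i<k. 1 - q ^ i / q ^ k) * (\<Prod>i\<in>{k<..M}. 1 - q ^ i / q ^ k)"
      unfolding split by (rule prod.union_disjoint) auto
    also have "(\<Prod>i<k. 1 - q ^ i / q ^ k) = qpoch (1 * q powi (- int k)) q k"
      unfolding qpoch_def by (simp add: power_int_minus divide_inverse mult_ac)
    also have "\<dots> = C * qpoch q q k"
      unfolding qpoch_negative_shift[OF assms(2) one_neq_zero] C_def by simp
    also have "(\<Prod>i\<in>{k<..M}. 1 - q ^ i / q ^ k) = qpoch q q (M - k)"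
      unfolding qpoch_def
      by (rule prod.reindex_bij_witness[of _ "\<lambda>i. Suc (k + i)" "\<lambda>i. i - Suc k"])
         (use assms in \<open>auto simp: field_simps simp flip: power_Suc power_add\<close>)
    finally show ?thesis
      unfolding num kronecker_coeff_def using C nz by (simp add: field_simps)
  qed
  have "qpoch (y * z) q M / qpoch y q (Suc M) = (\<Prod>i<M. 1 - y * (z * q ^ i)) / (\<Prod>i\<le>M. 1 - y * q ^ i)"
    unfolding qpoch_def lessThan_Suc_atMost by (simp add: mult_ac)
  also have "\<dots> = (\<Sum>k\<le>M. (\<Prod>i<M. 1 - z * q ^ i / q ^ k) / (\<Prod>i\<in>{..M} - {k}. 1 - q ^ i / q ^ k) / (1 - y * q ^ k))"
    by (rule partial_fractions[OF inj]) (use assms in auto)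
  also have "\<dots> = (\<Sum>k\<le>M. kronecker_coeff z q k (M - k) * (z ^ k / (1 - y * q ^ k)))"
    by (intro sum.cong) (auto simp: coef)
  finally show ?thesis .
qed

lemma kronecker_finite:
  assumes "norm q < 1" "q \<noteq> 0" "z \<noteq> 0" "a \<noteq> 0" and a: "\<And>i::int. a * q powi i \<noteq> 1"
  shows "qpoch (a * z) q N * qpoch (q / (a * z)) q N / (qpoch a q (Suc N) * qpoch (q / a) q N) =
    (\<Sum>n\<in>{- int N..int N}. kronecker_coeff z q (nat (int N + n)) (nat (int N - n)) * (z powi n / (1 - a * q powi n)))"
proof -
  define C where "C = theta_term a q (int N) * q powi (- (int N * int N))"
  have C: "C \<noteq> 0"
    using assms by (simp add: C_def theta_term_def)
  \<comment> \<open>Of the 2 N + 1 poles the middle one is now at a = 1, so they are indexed by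
    -N..N. The price is a factor z^N, the difference between z^(N+n) and z^n.\<close>
  define y where "y = a * q powi (- int N)"
  have yq: "y * q ^ k = a * q powi (int k - int N)" for k
    using assms by (simp add: y_def power_int_diff power_int_minus field_simps)
  have "qpoch (y * z) q (2 * N) = qpoch (a * z * q powi (- int N)) q (N + N)"
    unfolding mult_2 by (simp only: y_def mult_ac)
  also have "\<dots> = C * z ^ N * qpoch (q / (a * z)) q N * qpoch (a * z) q N"
    unfolding qpoch_add qpoch_negative_shift[OF assms(2) no_zero_divisors[OF assms(4,3)]] C_def mult.assoc[of "a * z"]
      powi_minus_mult_power[OF assms(2)] theta_term_mult_right by (simp add: mult_ac)
  finally have num: "qpoch (y * z) q (2 * N) = C * z ^ N * qpoch (q / (a * z)) q N * qpoch (a * z) q N" .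
  have "qpoch y q (Suc (2 * N)) = qpoch (a * q powi (- int N)) q (N + Suc N)"
    unfolding mult_2 by (simp only: y_def add_Suc_right)
  also have "\<dots> = C * qpoch (q / a) q N * qpoch a q (Suc N)"
    unfolding qpoch_add qpoch_negative_shift[OF assms(2,4)] C_def mult.assoc[of a]
      powi_minus_mult_power[OF assms(2)] by (simp add: mult_ac)
  finally have den: "qpoch y q (Suc (2 * N)) = C * qpoch (q / a) q N * qpoch a q (Suc N)" .
  have "z ^ N * (qpoch (a * z) q N * qpoch (q / (a * z)) q N / (qpoch a q (Suc N) * qpoch (q / a) q N)) =
      qpoch (y * z) q (2 * N) / qpoch y q (Suc (2 * N))"
    unfolding num den using C by (simp add: mult_ac)
  also have "\<dots> = (\<Sum>k\<le>2 * N. kronecker_coeff z q k (2 * N - k) * (z ^ k / (1 - y * q ^ k)))"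
    by (rule kronecker_finite_aux[OF assms(1-3)]) (use a in \<open>simp add: yq\<close>)
  also have "\<dots> = (\<Sum>n\<in>{- int N..int N}. kronecker_coeff z q (nat (int N + n)) (nat (int N - n)) *
      (z ^ nat (int N + n) / (1 - a * q powi n)))"
    by (rule sum.reindex_bij_witness[of _ "\<lambda>m. nat (int N + m)" "\<lambda>k. int k - int N"])
       (auto simp: yq nat_diff_distrib' intro!: arg_cong2[of _ _ _ _ "kronecker_coeff z q"])
  also have "\<dots> = z ^ N * (\<Sum>n\<in>{- int N..int N}. kronecker_coeff z q (nat (int N + n)) (nat (int N - n)) *
      (z powi n / (1 - a * q powi n)))"
    unfolding sum_distrib_left
  proof (rule sum.cong)
    fix n assume "n \<in> {- int N..int N}"
    then have "z ^ nat (int N + n) = z powi (int N + n)"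
      by (simp add: power_int_def)
    also have "\<dots> = z ^ N * z powi n"
      using assms by (simp add: power_int_add)
    finally show "kronecker_coeff z q (nat (int N + n)) (nat (int N - n)) * (z ^ nat (int N + n) / (1 - a * q powi n)) =
        z ^ N * (kronecker_coeff z q (nat (int N + n)) (nat (int N - n)) * (z powi n / (1 - a * q powi n)))"
      by (simp add: mult_ac)
  qed simp
  finally show ?thesis
    by (rule mult_left_cancel[THEN iffD1, rotated]) (use assms in simp)
qed

text \<open>Towards plus infinity the terms decay like z^n, towards minus infinity like (q/z)^n:
  this is the reason for the annulus |q| < |z| < 1.\<close>

lemma kronecker_summable:
  fixes a q z :: complex
  assumes "norm q < 1" "q \<noteq> 0" "a \<noteq> 0" "norm q < norm z" "norm z < 1"
    and a: "\<And>i::int. a * q powi i \<noteq> 1"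
  shows "(\<lambda>n. norm (z powi n / (1 - a * q powi n))) summable_on UNIV"
proof (rule summable_on_int_norm)
  have z: "z \<noteq> 0" using assms by auto
  have q0: "(\<lambda>n. q ^ n) \<longlonglongrightarrow> 0"
    using assms by (intro LIMSEQ_power_zero) auto
  have main: "summable (\<lambda>n. norm (w ^ n / d n))" if "d \<longlonglongrightarrow> l" "l \<noteq> 0" "norm w < 1"
    for w l :: complex and d
  proof -
    have "Bseq (\<lambda>n. inverse (d n))"
      using tendsto_inverse[OF that(1,2)] by (rule convergent_imp_Bseq[OF convergentI])
    then obtain K where K: "\<And>n. norm (inverse (d n)) \<le> K"
      unfolding Bseq_def by blast
    show ?thesis
    proof (rule summable_comparison_test')
      show "summable (\<lambda>n. K * norm w ^ n)"
        using that by (intro summable_mult summable_geometric) auto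
      show "norm (norm (w ^ n / d n)) \<le> K * norm w ^ n" for n
        using mult_right_mono[OF K[of n], of "norm w ^ n"]
        by (simp add: divide_inverse norm_mult norm_power mult_ac)
    qed
  qed
  have "(\<lambda>n. 1 - a * q ^ n) \<longlonglongrightarrow> 1 - a * 0"
    by (intro tendsto_intros q0)
  from main[OF this _ assms(5)] show "summable (\<lambda>n. norm (z powi int n / (1 - a * q powi int n)))"
    by simp
  have "(\<lambda>n. q ^ n - a) \<longlonglongrightarrow> 0 - a"
    by (intro tendsto_intros q0)
  from main[OF this, of "q / z"] have "summable (\<lambda>n. norm ((q / z) ^ n / (q ^ n - a)))"
    using assms z by (simp add: norm_divide)
  moreover have "(q / z) ^ n / (q ^ n - a) = z powi (- int n) / (1 - a * q powi (- int n))" for n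
  proof -
    have "q ^ n - a = q ^ n * (1 - a * q powi (- int n))"
      using assms by (simp add: power_int_minus field_simps)
    then show ?thesis
      using assms z by (simp add: power_divide power_int_minus field_simps)
  qed
  ultimately show "summable (\<lambda>n. norm (z powi (- int n) / (1 - a * q powi (- int n))))"
    by simp
qed

theorem kronecker_sum:
  assumes "norm q < 1" "q \<noteq> 0" "a \<noteq> 0" "norm q < norm z" "norm z < 1"
    and a: "\<And>i::int. a * q powi i \<noteq> 1"
  shows "((\<lambda>n. z powi n / (1 - a * q powi n)) has_sum
    (qpoch_inf q q)\<^sup>2 * theta (a * z) q / (theta a q * theta z q)) UNIV"
proof -
  have z: "z \<noteq> 0" using assms by auto
  have qz: "norm (q / z) < 1" using assms z by (simp add: norm_divide)
  have E: "qpoch_inf q q \<noteq> 0"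
    using assms by (intro qpoch_inf_nonzero')
  have ta: "theta a q \<noteq> 0"
    by (rule theta_nonzero) (use assms in auto)
  have tz: "theta z q \<noteq> 0"
    unfolding theta_def using assms qz by (simp add: qpoch_inf_nonzero')
  have ne1: "q * q ^ i \<noteq> 1" for i
    by (rule mult_power_neq_1) (use assms in auto)
  obtain B1 where B1: "B1 > 0" "\<And>n. norm (qpoch (q / z) q n) \<le> B1"
    using qpoch_bounded[OF assms(1)] by blast
  obtain B2 where B2: "B2 > 0" "\<And>n. norm (qpoch z q n) \<le> B2"
    using qpoch_bounded[OF assms(1)] by blast
  obtain B3 where B3: "B3 > 0" "\<And>n. norm (inverse (qpoch q q n)) \<le> B3"
    using qpoch_inverse_bounded[OF assms(1) ne1] by blast
  let ?f = "\<lambda>n. z powi n / (1 - a * q powi n)"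
  note summ = kronecker_summable[OF assms]
  have "(\<lambda>N. \<Sum>n\<in>{- int N..int N}. kronecker_coeff z q (nat (int N + n)) (nat (int N + (- n))) * ?f n)
      \<longlonglongrightarrow> theta z q / (qpoch_inf q q * qpoch_inf q q) * (\<Sum>\<^sub>\<infinity>n. ?f n)"
  proof (rule tendsto_infsum_symmetric[OF summ])
    fix m :: int
    show "(\<lambda>N. kronecker_coeff z q (nat (int N + m)) (nat (int N + (- m)))) \<longlonglongrightarrow> theta z q / (qpoch_inf q q * qpoch_inf q q)"
      unfolding kronecker_coeff_def theta_def mult.commute[of "qpoch_inf z q"] using E
      by (intro tendsto_intros filterlim_compose[OF qpoch_tendsto[OF assms(1)]] filterlim_nat_int_add) auto
    show "norm (kronecker_coeff z q (nat (int N + m)) (nat (int N + (- m)))) \<le> (B1 * B2) * (B3 * B3)" for N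
      unfolding kronecker_coeff_def divide_inverse[where a = "x * y" for x y] norm_mult inverse_mult_distrib
      by (intro mult_mono B1 B2 B3) (use B1 B2 B3 in auto)
  qed
  then have "(\<lambda>N. qpoch (a * z) q N * qpoch (q / (a * z)) q N / (qpoch a q (Suc N) * qpoch (q / a) q N))
      \<longlonglongrightarrow> theta z q / (qpoch_inf q q * qpoch_inf q q) * (\<Sum>\<^sub>\<infinity>n. ?f n)"
    by (simp only: kronecker_finite[OF assms(1,2) z assms(3) a] add_uminus_conv_diff)
  moreover have "(\<lambda>N. qpoch (a * z) q N * qpoch (q / (a * z)) q N / (qpoch a q (Suc N) * qpoch (q / a) q N))
      \<longlonglongrightarrow> theta (a * z) q / theta a q"
    using ta unfolding theta_def
    by (intro tendsto_intros qpoch_tendsto[OF assms(1)] LIMSEQ_Suc) auto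
  ultimately have "theta z q / (qpoch_inf q q * qpoch_inf q q) * (\<Sum>\<^sub>\<infinity>n. ?f n) = theta (a * z) q / theta a q"
    by (rule LIMSEQ_unique)
  then have "(\<Sum>\<^sub>\<infinity>n. ?f n) = (qpoch_inf q q)\<^sup>2 * theta (a * z) q / (theta a q * theta z q)"
    using E ta tz by (simp add: field_simps power2_eq_square)
  then show ?thesis
    using has_sum_infsum[OF abs_summable_summable[OF summ]] by simp
qed

section \<open>Weierstrass' three-term relation\<close>

lemma has_sum_times:
  fixes f :: "'a \<Rightarrow> 'c :: {banach, real_normed_field}" and g :: "'b \<Rightarrow> 'c"
  assumes f: "(\<lambda>x. norm (f x)) summable_on A" and g: "(\<lambda>y. norm (g y)) summable_on B"
  shows "((\<lambda>(x, y). f x * g y) has_sum infsum f A * infsum g B) (A \<times> B)"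
proof (rule has_sum_SigmaI)
  have "(\<lambda>(x, y). norm (f x) * norm (g y)) summable_on A \<times> B"
  proof (rule summable_on_SigmaI)
    show "((\<lambda>y. case (x, y) of (x, y) \<Rightarrow> norm (f x) * norm (g y)) has_sum
        norm (f x) * infsum (\<lambda>y. norm (g y)) B) B" for x
      unfolding prod.case by (rule has_sum_cmult_right[OF has_sum_infsum[OF g]])
    show "(\<lambda>x. norm (f x) * infsum (\<lambda>y. norm (g y)) B) summable_on A"
      by (rule summable_on_cmult_left[OF f])
  qed auto
  then have "(\<lambda>p. norm (case p of (x, y) \<Rightarrow> f x * g y)) summable_on A \<times> B"
    by (simp add: case_prod_unfold norm_mult)
  then show "(\<lambda>(x, y). f x * g y) summable_on A \<times> B"
    by (rule abs_summable_summable)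
  show "((\<lambda>x. f x * infsum g B) has_sum infsum f A * infsum g B) A"
    by (rule has_sum_cmult_left[OF has_sum_infsum[OF abs_summable_summable[OF f]]])
  show "((\<lambda>y. case (x, y) of (x, y) \<Rightarrow> f x * g y) has_sum f x * infsum g B) B" for x
    unfolding prod.case by (rule has_sum_cmult_right[OF has_sum_infsum[OF abs_summable_summable[OF g]]])
qed

lemma theta_term_minus: "theta_term (- z) q n = q powi tri n * z powi n"
proof -
  have "(-1) powi n * (-1) powi n = (1 :: complex)"
    by (simp flip: power_int_mult_distrib)
  moreover have "theta_term (- z) q n = ((-1) powi n * (-1) powi n) * (q powi tri n * z powi n)"
    unfolding theta_term_def using power_int_mult_distrib[of "-1" z n] by simp
  ultimately show ?thesis
    by simp
qed

lemma power_int_square_base: "(x\<^sup>2) powi n = x powi (2 * n)" for x :: complex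
  by (simp add: power_int_mult)

lemma power_int_minus_one_even: "even n \<Longrightarrow> (-1) powi n = (1 :: complex)"
  by (auto simp: power_int_mult elim!: evenE)

text \<open>Pairs of equal parity are (k + l, k - l), and \<open>tri (k + l) + tri (k - l)\<close> =
  k^2 - k + l^2 separates the variables; the linear term left in \<open>l\<close> becomes the factor
  q in the second argument. The total sign is 1, which the minus signs in the arguments
  express.\<close>

lemma theta_term_times_even:
  assumes "q \<noteq> 0" "u \<noteq> 0" "v \<noteq> 0"
  shows "theta_term u q (k + l) * theta_term v q (k - l) =
    theta_term (- (u * v)) (q\<^sup>2) k * theta_term (- (q * (u / v))) (q\<^sup>2) l"
proof -
  have "2 * (tri (k + l) + tri (k - l)) = 2 * (2 * tri k + (2 * tri l + l))"
    unfolding distrib_left tri_double by (simp add: algebra_simps)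
  then have e: "tri (k + l) + tri (k - l) = 2 * tri k + (2 * tri l + l)"
    by (rule mult_left_cancel[THEN iffD1, rotated]) simp
  have "(-1) powi (k + l) * (-1) powi (k - l) = ((-1) powi ((k + l) + (k - l)) :: complex)"
    by (rule power_int_add[symmetric]) simp
  also have "\<dots> = 1"
    by (rule power_int_minus_one_even) simp
  finally have sign: "(-1) powi (k + l) * (-1) powi (k - l) = (1 :: complex)" .
  have "theta_term u q (k + l) * theta_term v q (k - l) = ((-1) powi (k + l) * (-1) powi (k - l)) *
      (q powi tri (k + l) * q powi tri (k - l)) * (u powi (k + l) * v powi (k - l))"
    by (simp only: theta_term_def mult_ac)
  also have "\<dots> = q powi (tri (k + l) + tri (k - l)) * (u powi (k + l) * v powi (k - l))"
    unfolding power_int_add[OF disjI1[OF assms(1)], of "tri (k + l)"] sign by simp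
  also have "\<dots> = theta_term (- (u * v)) (q\<^sup>2) k * theta_term (- (q * (u / v))) (q\<^sup>2) l"
    unfolding e theta_term_minus power_int_square_base using assms
    by (simp add: power_int_add power_int_diff power_int_mult_distrib power_int_divide_distrib)
  finally show ?thesis .
qed

text \<open>For the remaining pairs the exponent is k^2 + l^2 - l. The sum of the indices is 2 k +
  1, whence the sign -1, and one power of \<open>v\<close> is left over.\<close>

lemma theta_term_times_odd:
  assumes "q \<noteq> 0" "u \<noteq> 0" "v \<noteq> 0"
  shows "theta_term u q (k + l) * theta_term v q (k - l + 1) =
    - v * (theta_term (- (q * (u * v))) (q\<^sup>2) k * theta_term (- (u / v)) (q\<^sup>2) l)"
proof -
  have "2 * (tri (k + l) + tri (k - l + 1)) = 2 * ((2 * tri k + k) + 2 * tri l)"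
    unfolding distrib_left tri_double by (simp add: algebra_simps)
  then have e: "tri (k + l) + tri (k - l + 1) = (2 * tri k + k) + 2 * tri l"
    by (rule mult_left_cancel[THEN iffD1, rotated]) simp
  have "(-1) powi (k + l) * (-1) powi (k - l + 1) = ((-1) powi ((k + l) + (k - l) + 1) :: complex)"
    by (simp flip: power_int_add add: add.assoc)
  also have "\<dots> = (-1) powi (2 * k) * (-1)"
    by (simp add: power_int_add)
  also have "\<dots> = - 1"
    by (simp add: power_int_minus_one_even)
  finally have sign: "(-1) powi (k + l) * (-1) powi (k - l + 1) = (-1 :: complex)" .
  have "theta_term u q (k + l) * theta_term v q (k - l + 1) = ((-1) powi (k + l) * (-1) powi (k - l + 1)) *
      (q powi tri (k + l) * q powi tri (k - l + 1)) * (u powi (k + l) * v powi (k - l + 1))"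
    by (simp only: theta_term_def mult_ac)
  also have "\<dots> = (-1) * q powi (tri (k + l) + tri (k - l + 1)) * (u powi (k + l) * v powi (k - l + 1))"
    unfolding power_int_add[OF disjI1[OF assms(1)], of "tri (k + l)"] sign by simp
  also have "\<dots> = - v * (theta_term (- (q * (u * v))) (q\<^sup>2) k * theta_term (- (u / v)) (q\<^sup>2) l)"
    unfolding e theta_term_minus power_int_square_base using assms
    by (simp add: power_int_add power_int_diff power_int_mult_distrib power_int_divide_distrib)
  finally show ?thesis .
qed

theorem theta_series_times_theta_series:
  assumes "norm q < 1" "q \<noteq> 0" "u \<noteq> 0" "v \<noteq> 0"
  shows "theta_series u q * theta_series v q = theta_series (- (u * v)) (q\<^sup>2) * theta_series (- (q * (u / v))) (q\<^sup>2)
    - v * (theta_series (- (q * (u * v))) (q\<^sup>2) * theta_series (- (u / v)) (q\<^sup>2))"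
proof -
  have q2: "norm (q\<^sup>2) < 1" "q\<^sup>2 \<noteq> 0"
    using assms by (auto simp: norm_power power_less_one_iff)
  define f where "f = (\<lambda>(m, n). theta_term u q m * theta_term v q n)"
  let ?E = "{(m, n). even (m + n :: int)}" and ?O = "{(m, n). odd (m + n :: int)}"
  have prod: "((\<lambda>(k, l). theta_term x (q\<^sup>2) k * theta_term y (q\<^sup>2) l) has_sum theta_series x (q\<^sup>2) * theta_series y (q\<^sup>2)) UNIV"
    if "x \<noteq> 0" "y \<noteq> 0" for x y
    using has_sum_times[OF theta_term_summable[OF q2 that(1)] theta_term_summable[OF q2 that(2)]]
    by (simp add: theta_series_def)
  have total: "(f has_sum theta_series u q * theta_series v q) UNIV"
    using has_sum_times[OF theta_term_summable[OF assms(1,2,3)] theta_term_summable[OF assms(1,2,4)]]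
    by (simp add: theta_series_def f_def)
  have even: "(f has_sum theta_series (- (u * v)) (q\<^sup>2) * theta_series (- (q * (u / v))) (q\<^sup>2)) ?E"
  proof (subst has_sum_reindex_bij_witness[where T = UNIV and i = "\<lambda>(k, l). (k + l, k - l)"
        and j = "\<lambda>(m, n). ((m + n) div 2, (m - n) div 2)"
        and h = "\<lambda>(k, l). theta_term (- (u * v)) (q\<^sup>2) k * theta_term (- (q * (u / v))) (q\<^sup>2) l", OF _ _ _ _ _ refl])
    show "((\<lambda>(k, l). theta_term (- (u * v)) (q\<^sup>2) k * theta_term (- (q * (u / v))) (q\<^sup>2) l) has_sum
        theta_series (- (u * v)) (q\<^sup>2) * theta_series (- (q * (u / v))) (q\<^sup>2)) UNIV"
      by (rule prod) (use assms in auto)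
    fix a assume a: "a \<in> ?E"
    obtain m n where mn: "a = (m, n)" by (cases a)
    have "even (m + n)"
      using a mn by simp
    then have [simp]: "(m + n) div 2 + (m - n) div 2 = m" "(m + n) div 2 - (m - n) div 2 = n"
      by presburger+
    show "(case case a of (m, n) \<Rightarrow> ((m + n) div 2, (m - n) div 2) of (k, l) \<Rightarrow>
        theta_term (- (u * v)) (q\<^sup>2) k * theta_term (- (q * (u / v))) (q\<^sup>2) l) = f a"
      unfolding mn prod.case theta_term_times_even[OF assms(2-4), symmetric] by (simp add: f_def)
  qed (auto, presburger+)
  have odd: "(f has_sum - v * (theta_series (- (q * (u * v))) (q\<^sup>2) * theta_series (- (u / v)) (q\<^sup>2))) ?O"
  proof (subst has_sum_reindex_bij_witness[where T = UNIV and i = "\<lambda>(k, l). (k + l, k - l + 1)"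
        and j = "\<lambda>(m, n). ((m + n) div 2, (m - n + 1) div 2)"
        and h = "\<lambda>p. - v * (case p of (k, l) \<Rightarrow> theta_term (- (q * (u * v))) (q\<^sup>2) k * theta_term (- (u / v)) (q\<^sup>2) l)", OF _ _ _ _ _ refl])
    show "((\<lambda>p. - v * (case p of (k, l) \<Rightarrow> theta_term (- (q * (u * v))) (q\<^sup>2) k * theta_term (- (u / v)) (q\<^sup>2) l)) has_sum
        - v * (theta_series (- (q * (u * v))) (q\<^sup>2) * theta_series (- (u / v)) (q\<^sup>2))) UNIV"
      by (rule has_sum_cmult_right[OF prod]) (use assms in auto)
    fix a assume a: "a \<in> ?O"
    obtain m n where mn: "a = (m, n)" by (cases a)
    have "odd (m + n)"
      using a mn by simp
    then have [simp]: "(m + n) div 2 + (m - n + 1) div 2 = m" "(m + n) div 2 - (m - n + 1) div 2 + 1 = n"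
      by presburger+
    show "- v * (case case a of (m, n) \<Rightarrow> ((m + n) div 2, (m - n + 1) div 2) of (k, l) \<Rightarrow>
        theta_term (- (q * (u * v))) (q\<^sup>2) k * theta_term (- (u / v)) (q\<^sup>2) l) = f a"
      unfolding mn prod.case theta_term_times_odd[OF assms(2-4), symmetric] by (simp add: f_def)
  qed (auto, presburger+)
  have "?E \<union> ?O = UNIV" "?E \<inter> ?O = {}"
    by auto
  with has_sum_Un_disjoint[OF even odd] total show ?thesis
    using has_sum_unique by fastforce
qed

theorem theta_times_theta:
  assumes "norm q < 1" "q \<noteq> 0" "u \<noteq> 0" "v \<noteq> 0"
  shows "(qpoch_inf q q)\<^sup>2 * (theta u q * theta v q) = (qpoch_inf (q\<^sup>2) (q\<^sup>2))\<^sup>2 *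
    (theta (- (u * v)) (q\<^sup>2) * theta (- (q * (u / v))) (q\<^sup>2)
      - v * (theta (- (q * (u * v))) (q\<^sup>2) * theta (- (u / v)) (q\<^sup>2)))"
proof -
  have q2: "norm (q\<^sup>2) < 1" "q\<^sup>2 \<noteq> 0"
    using assms by (auto simp: norm_power power_less_one_iff)
  have "theta_series x (q\<^sup>2) = qpoch_inf (q\<^sup>2) (q\<^sup>2) * theta x (q\<^sup>2)" if "x \<noteq> 0" for x
    by (rule jacobi_triple_product[OF q2 that])
  moreover have "theta_series x q = qpoch_inf q q * theta x q" if "x \<noteq> 0" for x
    by (rule jacobi_triple_product[OF assms(1,2) that])
  ultimately show ?thesis
    using theta_series_times_theta_series[OF assms] assms by (simp add: power2_eq_square algebra_simps)
qed

text \<open>Each product \<open>theta (x * y) q * theta (x / y) q\<close> is a 2 by 2 determinant in functions of \<open>x\<close>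
  and \<open>y\<close>, so that this is the Pluecker relation.\<close>

theorem weierstrass_three_term:
  assumes "norm q < 1" "q \<noteq> 0" and nz: "x \<noteq> 0" "y \<noteq> 0" "u \<noteq> 0" "v \<noteq> 0"
  shows "theta (x * y) q * theta (x / y) q * (theta (u * v) q * theta (u / v) q)
    - theta (x * v) q * theta (x / v) q * (theta (u * y) q * theta (u / y) q)
    = u / y * (theta (y * v) q * theta (y / v) q * (theta (x * u) q * theta (x / u) q))"
proof -
  have E: "qpoch_inf q q \<noteq> 0"
    using assms by (intro qpoch_inf_nonzero')
  define C where "C = (qpoch_inf (q\<^sup>2) (q\<^sup>2))\<^sup>2 / (qpoch_inf q q)\<^sup>2"
  define a where "a x = theta (- (x\<^sup>2)) (q\<^sup>2) / x" for x
  define b where "b x = theta (- (q * x\<^sup>2)) (q\<^sup>2)" for x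
  have W: "theta (x * y) q * theta (x / y) q = C * (x * (a x * b y - b x * a y))"
    if "x \<noteq> 0" "y \<noteq> 0" for x y
  proof -
    \<comment> \<open>The product and the quotient of the two arguments involve only one variable
      each, so the dissection separates \<open>x\<close> from \<open>y\<close>.\<close>
    have "x * y * (x / y) = x\<^sup>2" "x * y / (x / y) = y\<^sup>2"
      using that by (simp_all add: power2_eq_square)
    moreover have "x * (a x * b y - b x * a y) = theta (- (x\<^sup>2)) (q\<^sup>2) * theta (- (q * y\<^sup>2)) (q\<^sup>2)
        - x / y * (theta (- (q * x\<^sup>2)) (q\<^sup>2) * theta (- (y\<^sup>2)) (q\<^sup>2))"
      using that by (simp add: a_def b_def right_diff_distrib)
    ultimately have "(qpoch_inf q q)\<^sup>2 * (theta (x * y) q * theta (x / y) q) =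
        (qpoch_inf (q\<^sup>2) (q\<^sup>2))\<^sup>2 * (x * (a x * b y - b x * a y))"
      using theta_times_theta[OF assms(1,2), of "x * y" "x / y"] that by simp
    then show ?thesis
      using E by (simp add: C_def eq_divide_eq mult.commute)
  qed
  show ?thesis
    \<comment> \<open>Each use of \<open>W\<close> contributes one factor: x and u in both terms on
      the left, y and x on the right. This accounts for u / y.\<close>
    unfolding W[OF nz(1,2)] W[OF nz(3,4)] W[OF nz(1,4)] W[OF nz(3,2)] W[OF nz(2,4)] W[OF nz(1,3)]
    using nz(2) by (simp add: algebra_simps)
qed

section \<open>Theta values in base q to the tenth\<close>

text \<open>The triple product in base q^2 at -q, a fixed point of z -> q^2 / z; hence the
  square.\<close>

lemma theta_phi_eq:
  assumes "norm q < 1" "q \<noteq> 0"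
  shows "theta_phi q = qpoch_inf (q\<^sup>2) (q\<^sup>2) * (qpoch_inf (- q) (q\<^sup>2))\<^sup>2"
proof -
  have q2: "norm (q\<^sup>2) < 1" "q\<^sup>2 \<noteq> 0"
    using assms by (auto simp: norm_power power_less_one_iff)
  have "theta_term (- q) (q\<^sup>2) n = q powi (n ^ 2)" for n
  proof -
    have "2 * tri n + n = n ^ 2"
      unfolding tri_double by (simp add: power2_eq_square algebra_simps)
    then show ?thesis
      unfolding theta_term_minus power_int_square_base power_int_add[OF disjI1[OF assms(2)], symmetric] by simp
  qed
  then have "theta_phi q = theta_series (- q) (q\<^sup>2)"
    by (simp add: theta_phi_def theta_series_def)
  also have "\<dots> = qpoch_inf (q\<^sup>2) (q\<^sup>2) * theta (- q) (q\<^sup>2)"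
    using jacobi_triple_product[OF q2] assms by simp
  also have "q\<^sup>2 / (- q) = - q"
    using assms by (simp add: power2_eq_square)
  then have "theta (- q) (q\<^sup>2) = (qpoch_inf (- q) (q\<^sup>2))\<^sup>2"
    by (simp add: theta_def power2_eq_square)
  finally show ?thesis .
qed

locale level_ten =
  fixes q :: complex
  assumes norm_q: "norm q < 1" and q_nz: "q \<noteq> 0"
begin

text \<open>The sign is a parameter so that \<open>t\<close> and \<open>s\<close> share their rules,
  and the exponent is an integer because differences of exponents occur in the three-term
  relation.\<close>

definition G :: "complex \<Rightarrow> int \<Rightarrow> complex" where
  "G s k = theta (s * q powi k) (q ^ 10)"

abbreviation "t \<equiv> G 1"
abbreviation "s \<equiv> G (-1)"
abbreviation "c \<equiv> qpoch_inf (q ^ 10) (q ^ 10)"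
abbreviation "d \<equiv> qpoch_inf (- (q ^ 10)) (q ^ 10)"
text \<open>\<open>p\<close> and \<open>r\<close> are square roots of \<open>t 5\<close> and
  \<open>s 5\<close>: the index 5 is its own reflection, but E(q) contains the corresponding product
  only once.\<close>

abbreviation "p \<equiv> qpoch_inf (q ^ 5) (q ^ 10)"
abbreviation "r \<equiv> qpoch_inf (- (q ^ 5)) (q ^ 10)"

lemma norm_power_less: "k > 0 \<Longrightarrow> norm (q ^ k) < 1"
  using norm_q by (simp add: norm_power power_less_one_iff)

lemma base: "norm (q ^ 10) < 1" "q ^ 10 \<noteq> 0"
  using norm_power_less q_nz by auto

lemma base_powi: "(q ^ 10) powi n = q powi (10 * n)"
  by (simp add: power_int_mult)

lemma powi_neq_1: "m \<noteq> 0 \<Longrightarrow> q powi m \<noteq> 1"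
proof
  assume m: "m \<noteq> 0" and "q powi m = 1"
  then have "norm q powi m = 1"
    by (metis norm_one norm_power_int)
  moreover have "norm q powi m < 1" if "m > 0"
  proof -
    have "norm q ^ nat m < 1"
      using that norm_q by (simp add: power_less_one_iff)
    then show ?thesis using that by (simp add: power_int_def)
  qed
  moreover have "norm q powi m > 1" if "m < 0"
  proof -
    have "norm q ^ nat (- m) < 1" "norm q ^ nat (- m) > 0"
      using that norm_q q_nz by (auto simp: power_less_one_iff)
    then show ?thesis using that by (simp add: power_int_def one_less_inverse power_inverse)
  qed
  ultimately show False using m by linarith
qed

text \<open>This keeps all denominators 1 + q^m away from 0. Squaring reduces it to the case without
  a sign, and m = 0 is excluded by -1 not being 1.\<close>

lemma minus_powi_neq_1: "- (q powi m) \<noteq> 1"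
proof
  assume *: "- (q powi m) = 1"
  then have "q powi (2 * m) = 1"
    by (metis minus_mult_minus mult_1 power2_eq_square power_int_mult power_int_numeral mult.commute)
  then have "m = 0"
    using powi_neq_1[of "2 * m"] by auto
  with * show False by simp
qed

lemma G_nonzero:
  assumes "e = -1 \<or> e = 1 \<and> \<not> 10 dvd k"
  shows "G e k \<noteq> 0"
  unfolding G_def
proof (rule theta_nonzero[OF base])
  show "e * q powi k \<noteq> 0"
    using assms q_nz by auto
  fix i :: int
  have "e * q powi k * (q ^ 10) powi i = e * q powi (k + 10 * i)"
    unfolding base_powi using q_nz by (simp add: power_int_add)
  moreover have "k + 10 * i \<noteq> 0" if "\<not> 10 dvd k"
    using that by presburger
  ultimately show "e * q powi k * (q ^ 10) powi i \<noteq> 1"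
    using assms powi_neq_1 minus_powi_neq_1 by auto
qed

lemma G_reflect:
  assumes "e * e = 1"
  shows "G e (10 - k) = G e k"
proof -
  have "e \<noteq> 0" using assms by auto
  then have "inverse e = e"
    using assms by (metis inverse_unique)
  then have "q ^ 10 / (e * q powi k) = e * q powi (10 - k)"
    using q_nz by (simp add: power_int_diff divide_inverse)
  then show ?thesis
    using theta_reflect[OF base(2), of "e * q powi k"] by (simp add: G_def)
qed

lemma G_minus:
  assumes "e * e = 1"
  shows "G e (- k) = - e * G e k / q powi k"
proof -
  have "e \<noteq> 0" using assms by auto
  then have "inverse e = e"
    using assms by (metis inverse_unique)
  then have "1 / (e * q powi k) = e * q powi (- k)"
    by (simp add: power_int_minus divide_inverse)
  then show ?thesis
    using theta_inverse[OF base, of "e * q powi k"] \<open>e \<noteq> 0\<close> q_nz \<open>inverse e = e\<close>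
    by (simp add: G_def divide_inverse mult_ac)
qed

lemma three_term:
  assumes "s1 * s1 = 1" "s2 * s2 = 1" "s3 * s3 = 1" "s4 * s4 = 1"
  shows "G (s1 * s2) (j + k) * G (s1 * s2) (j - k) * (G (s3 * s4) (m + n) * G (s3 * s4) (m - n))
    - G (s1 * s4) (j + n) * G (s1 * s4) (j - n) * (G (s3 * s2) (m + k) * G (s3 * s2) (m - k))
    = s3 * s2 * q powi (m - k) * (G (s2 * s4) (k + n) * G (s2 * s4) (k - n) * (G (s1 * s3) (j + m) * G (s1 * s3) (j - m)))"
proof -
  have mult: "a * q powi x * (b * q powi y) = a * b * q powi (x + y)" for a b x y
    using q_nz by (simp add: power_int_add)
  have div: "a * q powi x / (b * q powi y) = a * b * q powi (x - y)" if "b * b = 1" for a b x y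
  proof -
    have "inverse b = b"
      using that by (metis inverse_unique)
    then show ?thesis
      using q_nz by (simp add: power_int_diff divide_inverse mult_ac)
  qed
  have nz: "a * q powi x \<noteq> 0" if "a * a = 1" for a x
    using that q_nz by auto
  show ?thesis
    using weierstrass_three_term[OF base nz[OF assms(1), of j] nz[OF assms(2), of k] nz[OF assms(3), of m] nz[OF assms(4), of n]]
    unfolding mult div[OF assms(2)] div[OF assms(4)] div[OF assms(3)] G_def .
qed

text \<open>The indices outside 0..5 that arise from the instances of \<open>three_term\<close>
  below and from the bilateral sums.\<close>

lemma G_reduce:
  assumes "e * e = 1"
  shows "G e 6 = G e 4" "G e 7 = G e 3" "G e 8 = G e 2" "G e 9 = G e 1"
    "G e (-1) = - e * G e 1 / q" "G e (-2) = - e * G e 2 / q ^ 2" "G e (-3) = - e * G e 3 / q ^ 3"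
    "G e (-7) = - e * G e 3 / q ^ 7"
  using G_reflect[OF assms, of 4] G_reflect[OF assms, of 3] G_reflect[OF assms, of 2]
    G_reflect[OF assms, of 1] G_minus[OF assms, of 1] G_minus[OF assms, of 2] G_minus[OF assms, of 3]
    G_minus[OF assms, of 7] by simp_all

text \<open>The points are x = q^3, y = -q, u = q^4, v = q. Multiplied by
  \<open>c\<^sup>2 * s 1\<close> and divided by \<open>t 1 * t 3 * t 5 * s 0 * s 2 * s 4\<close>,
  the three terms are the first bilateral sum, half of phi(q) phi(q^5), and the second bilateral
  sum.\<close>

lemma relation_A: "s 4 * s 2 * t 5 * t 3 - t 4 * t 2 * s 5 * s 3 = q ^ 2 * (s 2 * s 0 * t 3 * t 1)"
  using three_term[of 1 "-1" 1 1 3 1 4 1] q_nz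
  by (simp add: G_reduce field_simps eval_nat_numeral)

text \<open>The points are x = q, y = -q^3, u = q^2, v = q^3. With \<open>s 3\<close> in place of
  \<open>s 1\<close> in the multiplier, the terms are half of phi(q) phi(q^5), the third and the
  fourth bilateral sum.\<close>

lemma relation_B: "t 4 * t 2 * s 5 * s 1 - s 4 * s 2 * t 5 * t 1 = q * (s 4 * s 0 * t 3 * t 1)"
proof -
  have "q\<^sup>2 * (t 4 * t 2 * s 5 * s 1 - s 4 * s 2 * t 5 * t 1) = q\<^sup>2 * (q * (s 4 * s 0 * t 3 * t 1))"
    using three_term[of 1 "-1" 1 1 1 3 2 3] q_nz
    by (simp add: G_reduce field_simps eval_nat_numeral)
  then show ?thesis
    using q_nz by simp
qed

text \<open>The choice v = -u makes u / v = -1, which brings in \<open>s 0\<close>; the same is done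
  in \<open>relation_E2\<close>. The two relations share two of their three terms and are used only
  as a pair.\<close>

lemma relation_E1: "s 3 * s 5 * s 4 * s 0 - s 4 * s 2 * s 1 * s 3 = t 1 * t 3 * t 4 * t 2"
  using three_term[of 1 "-1" 1 "-1" 4 "-1" 2 2] q_nz
  by (simp add: G_reduce field_simps eval_nat_numeral)

lemma relation_E2: "q * (s 1 * s 5 * s 2 * s 0) = s 4 * s 2 * s 1 * s 3 - t 1 * t 3 * t 4 * t 2"
proof -
  have "q\<^sup>2 * (q * (s 1 * s 5 * s 2 * s 0)) = q\<^sup>2 * (s 4 * s 2 * s 1 * s 3 - t 1 * t 3 * t 4 * t 2)"
    using three_term[of 1 "-1" 1 "-1" 2 "-3" 4 4] q_nz
    by (simp add: G_reduce field_simps eval_nat_numeral)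
  then show ?thesis
    using q_nz by simp
qed

section \<open>Euler products and phi(q) phi(q^5) in terms of theta values\<close>

lemma G_eq_qpoch_inf:
  assumes "e * e = 1" "k \<le> 10"
  shows "G e (int k) = qpoch_inf (e * q ^ k) (q ^ 10) * qpoch_inf (e * q ^ (10 - k)) (q ^ 10)"
proof -
  have "inverse e = e"
    using assms by (metis inverse_unique)
  then have "q ^ 10 / (e * q ^ k) = e * q ^ (10 - k)"
    using q_nz assms by (simp add: power_diff divide_inverse)
  then show ?thesis
    by (simp add: G_def theta_def)
qed

lemma G_qpoch_inf:
  assumes "e * e = 1"
  shows "G e 1 = qpoch_inf (e * q) (q ^ 10) * qpoch_inf (e * q ^ 9) (q ^ 10)"
    "G e 2 = qpoch_inf (e * q ^ 2) (q ^ 10) * qpoch_inf (e * q ^ 8) (q ^ 10)"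
    "G e 3 = qpoch_inf (e * q ^ 3) (q ^ 10) * qpoch_inf (e * q ^ 7) (q ^ 10)"
    "G e 4 = qpoch_inf (e * q ^ 4) (q ^ 10) * qpoch_inf (e * q ^ 6) (q ^ 10)"
    "G e 5 = (qpoch_inf (e * q ^ 5) (q ^ 10))\<^sup>2"
  using G_eq_qpoch_inf[OF assms, of 1] G_eq_qpoch_inf[OF assms, of 2] G_eq_qpoch_inf[OF assms, of 3]
    G_eq_qpoch_inf[OF assms, of 4] G_eq_qpoch_inf[OF assms, of 5] by (simp_all add: power2_eq_square)

text \<open>The 2 is the leading factor 1 - a at a = -1; what remains are two copies of
  \<open>d\<close>.\<close>

lemma s_0: "s 0 = 2 * d\<^sup>2"
  using qpoch_inf_Suc[OF base(1), of "-1"] by (simp add: G_def theta_def power2_eq_square)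

lemma qpoch_inf_dissect_10:
  "qpoch_inf (e * q) q = qpoch_inf (e * q) (q ^ 10) * qpoch_inf (e * q ^ 2) (q ^ 10) * qpoch_inf (e * q ^ 3) (q ^ 10)
    * qpoch_inf (e * q ^ 4) (q ^ 10) * qpoch_inf (e * q ^ 5) (q ^ 10) * qpoch_inf (e * q ^ 6) (q ^ 10) * qpoch_inf (e * q ^ 7) (q ^ 10)
    * qpoch_inf (e * q ^ 8) (q ^ 10) * qpoch_inf (e * q ^ 9) (q ^ 10) * qpoch_inf (e * q ^ 10) (q ^ 10)"
proof -
  have "e * q * q ^ i = e * q ^ Suc i" for i
    by simp
  then have "qpoch_inf (e * q) q = (\<Prod>i<10. qpoch_inf (e * q ^ Suc i) (q ^ 10))"
    using qpoch_inf_dissect[OF norm_q, of 10 "e * q"] by (simp only: zero_less_numeral)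
  then show ?thesis
    by (simp add: lessThan_Suc numeral_eq_Suc mult_ac del: power_Suc)
qed

lemma qpoch_inf_dissect_5:
  "qpoch_inf a (q\<^sup>2) = qpoch_inf a (q ^ 10) * qpoch_inf (a * q ^ 2) (q ^ 10) * qpoch_inf (a * q ^ 4) (q ^ 10)
    * qpoch_inf (a * q ^ 6) (q ^ 10) * qpoch_inf (a * q ^ 8) (q ^ 10)"
proof -
  have "qpoch_inf a (q\<^sup>2) = (\<Prod>i<5. qpoch_inf (a * q ^ (2 * i)) (q ^ 10))"
    using qpoch_inf_dissect[of "q\<^sup>2" 5 a] norm_power_less[of 2] by (simp flip: power_mult)
  then show ?thesis
    by (simp add: lessThan_Suc numeral_eq_Suc mult_ac del: power_Suc)
qed

lemma E_1: "euler_E q = c * t 1 * t 2 * t 3 * t 4 * p"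
  using qpoch_inf_dissect_10[of 1] by (simp add: euler_E_eq_qpoch_inf G_qpoch_inf mult_ac)

lemma E_2: "euler_E (q ^ 2) = c * t 2 * t 4"
  using qpoch_inf_dissect_5[of "q ^ 2"] by (simp add: euler_E_eq_qpoch_inf G_qpoch_inf flip: power_add)

lemma E_10: "euler_E (q ^ 10) = c"
  by (simp add: euler_E_eq_qpoch_inf)

lemma E_5: "euler_E (q ^ 5) = p * c"
proof -
  have "qpoch_inf (q ^ 5) (q ^ 5) = (\<Prod>i<2. qpoch_inf (q ^ 5 * (q ^ 5) ^ i) ((q ^ 5) ^ 2))"
    by (rule qpoch_inf_dissect) (simp_all add: norm_power_less)
  then show ?thesis
    by (simp add: euler_E_eq_qpoch_inf lessThan_nat_numeral lessThan_Suc flip: power_mult power_add)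
qed

lemma double_base: "qpoch_inf (a\<^sup>2) (q ^ 20) = qpoch_inf a (q ^ 10) * qpoch_inf (- a) (q ^ 10)"
  using qpoch_inf_mult_neg[OF base(1), of a] by (simp flip: power_mult)

lemma E_20: "euler_E (q ^ 20) = c * d"
  using double_base[of "q ^ 10"] by (simp add: euler_E_eq_qpoch_inf flip: power_mult)

lemma qpoch_inf_minus: "qpoch_inf (- q) q = s 1 * s 2 * s 3 * s 4 * r * d"
  using qpoch_inf_dissect_10[of "-1"] by (simp add: G_qpoch_inf power2_eq_square mult_ac)

lemma E_4: "euler_E (q ^ 4) = c * d * t 2 * s 2 * t 4 * s 4"
proof -
  have "qpoch_inf (q ^ 4) (q ^ 4) = (\<Prod>i<5. qpoch_inf (q ^ 4 * (q ^ 4) ^ i) ((q ^ 4) ^ 5))"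
    by (rule qpoch_inf_dissect) (simp_all add: norm_power_less)
  \<comment> \<open>Base q^20 is split into base q^10 by \<open>double_base\<close>, for which each
    argument is written as a square.\<close>
  also have "\<dots> = qpoch_inf ((q ^ 2)\<^sup>2) (q ^ 20) * qpoch_inf ((q ^ 4)\<^sup>2) (q ^ 20) * qpoch_inf ((q ^ 6)\<^sup>2) (q ^ 20)
      * qpoch_inf ((q ^ 8)\<^sup>2) (q ^ 20) * qpoch_inf ((q ^ 10)\<^sup>2) (q ^ 20)"
    by (simp add: lessThan_nat_numeral lessThan_Suc mult_ac flip: power_mult power_add)
  finally show ?thesis
    unfolding euler_E_eq_qpoch_inf double_base by (simp add: G_qpoch_inf mult_ac)
qed

lemma qpoch_infs_nonzero: "c \<noteq> 0" "d \<noteq> 0" "p \<noteq> 0" "r \<noteq> 0"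
  using norm_power_less[of 5] norm_power_less[of 10] by (simp_all add: qpoch_inf_nonzero'[OF base(1)])

text \<open>Euler's identity at x = q^5, with (q^10; q^10) cancelled.\<close>

lemma p_r_d: "p * r * d = 1"
proof -
  have "qpoch_inf (q ^ 5) (q ^ 5) * qpoch_inf (- (q ^ 5)) (q ^ 5) = qpoch_inf ((q ^ 5)\<^sup>2) ((q ^ 5)\<^sup>2)"
    by (rule qpoch_inf_mult_neg) (simp add: norm_power_less)
  moreover have "qpoch_inf (- (q ^ 5)) (q ^ 5) = (\<Prod>i<2. qpoch_inf (- (q ^ 5) * (q ^ 5) ^ i) ((q ^ 5) ^ 2))"
    by (rule qpoch_inf_dissect) (simp_all add: norm_power_less)
  then have "qpoch_inf (- (q ^ 5)) (q ^ 5) = r * d"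
    by (simp add: lessThan_nat_numeral lessThan_Suc mult_ac flip: power_mult power_add)
  ultimately have "c * (p * r * d) = c * 1"
    using E_5 by (simp add: euler_E_eq_qpoch_inf mult_ac flip: power_mult)
  then show ?thesis
    using qpoch_infs_nonzero by (metis mult_left_cancel)
qed

lemma s_0_s_5_t_5: "t 5 * s 5 * s 0 = 2"
proof -
  have "t 5 * s 5 * s 0 = 2 * (p * r * d)\<^sup>2"
    by (simp add: G_qpoch_inf s_0 power2_eq_square)
  then show ?thesis by (simp only: p_r_d) simp
qed

text \<open>Euler's identity at x = q; the factors from exponents divisible by 5 drop out by
  \<open>p_r_d\<close>.\<close>

lemma euler_relation: "t 1 * t 3 * s 1 * s 2 * s 3 * s 4 = 1"
proof -
  have "qpoch_inf q q * qpoch_inf (- q) q = qpoch_inf (q ^ 2) (q ^ 2)"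
    by (rule qpoch_inf_mult_neg[OF norm_q])
  then have "(c * t 2 * t 4) * (t 1 * t 3 * s 1 * s 2 * s 3 * s 4 * (p * r * d)) = (c * t 2 * t 4) * 1"
    using E_1 E_2 by (simp add: euler_E_eq_qpoch_inf qpoch_inf_minus mult_ac)
  moreover have "c * t 2 * t 4 \<noteq> 0"
    using qpoch_infs_nonzero G_nonzero[of 1] by simp
  ultimately have "t 1 * t 3 * s 1 * s 2 * s 3 * s 4 * (p * r * d) = 1"
    by (metis mult_left_cancel)
  then show ?thesis
    by (simp only: p_r_d mult_1_right)
qed

text \<open>Passing from (u, v) = (-q, q^3) to (q, -q^3) preserves u v and u / v but flips the sign
  of the prefactor v in the dissection. In the sum of the two products the odd parts, multiples of
  \<open>X\<close>, cancel and the even parts double.\<close>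

lemma relation_D: "s 1 * t 3 + t 1 * s 3 = s 0 * (t 2 * t 4 * s 2 * s 4)"
proof -
  have q20: "(q ^ 10)\<^sup>2 = q ^ 20" by (simp flip: power_mult)
  have th: "theta (a\<^sup>2) (q ^ 20) = theta a (q ^ 10) * theta (- a) (q ^ 10)" for a
  proof -
    have "q ^ 20 / a\<^sup>2 = (q ^ 10 / a)\<^sup>2" by (simp add: power_divide flip: power_mult)
    then show ?thesis
      unfolding theta_def by (simp only: double_base) (simp add: mult_ac)
  qed
  define X where "X = theta (q ^ 14) (q ^ 20) * theta (1 / q\<^sup>2) (q ^ 20)"
  have args: "- (- q * q ^ 3) = q ^ 4" "- (q ^ 10 * (- q / q ^ 3)) = q ^ 8"
    "- (q ^ 10 * (- q * q ^ 3)) = q ^ 14" "- (- q / q ^ 3) = 1 / q\<^sup>2"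
    "- (q * - (q ^ 3)) = q ^ 4" "- (q ^ 10 * (q / - (q ^ 3))) = q ^ 8"
    "- (q ^ 10 * (q * - (q ^ 3))) = q ^ 14" "- (q / - (q ^ 3)) = 1 / q\<^sup>2"
    using q_nz by (simp_all add: field_simps eval_nat_numeral)
  have cd: "qpoch_inf (q ^ 20) (q ^ 20) = c * d"
    using E_20 by (simp add: euler_E_eq_qpoch_inf)
  have nz: "- q \<noteq> 0" "q ^ 3 \<noteq> 0" "- (q ^ 3) \<noteq> 0"
    using q_nz by auto
  have "c\<^sup>2 * (theta (- q) (q ^ 10) * theta (q ^ 3) (q ^ 10)) = (c * d)\<^sup>2 *
      (theta (q ^ 4) (q ^ 20) * theta (q ^ 8) (q ^ 20) - q ^ 3 * X)"
    using theta_times_theta[OF base nz(1,2)] unfolding q20 args cd X_def .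
  moreover have "c\<^sup>2 * (theta q (q ^ 10) * theta (- (q ^ 3)) (q ^ 10)) = (c * d)\<^sup>2 *
      (theta (q ^ 4) (q ^ 20) * theta (q ^ 8) (q ^ 20) + q ^ 3 * X)"
    using theta_times_theta[OF base q_nz nz(3)] unfolding q20 args cd X_def by simp
  ultimately have "c\<^sup>2 * (s 1 * t 3 + t 1 * s 3) = c\<^sup>2 * (2 * d\<^sup>2 * (theta (q ^ 4) (q ^ 20) * theta (q ^ 8) (q ^ 20)))"
    unfolding G_def by (simp add: algebra_simps power2_eq_square)
  then have "s 1 * t 3 + t 1 * s 3 = 2 * d\<^sup>2 * (theta (q ^ 4) (q ^ 20) * theta (q ^ 8) (q ^ 20))"
    using qpoch_infs_nonzero by (metis mult_left_cancel power_not_zero)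
  moreover have "theta (q ^ 4) (q ^ 20) = t 2 * s 2" "theta (q ^ 8) (q ^ 20) = t 4 * s 4"
    using th[of "q ^ 2"] th[of "q ^ 4"] by (simp_all add: G_def flip: power_mult)
  ultimately show ?thesis
    by (simp add: s_0 mult_ac)
qed

lemma phi_phi: "theta_phi q * theta_phi (q ^ 5) = c\<^sup>2 * (t 2 * t 4 * (s 1)\<^sup>2 * (s 3)\<^sup>2 * (s 5)\<^sup>2)"
proof -
  have "qpoch_inf (- q) (q\<^sup>2) = s 1 * s 3 * r"
    using qpoch_inf_dissect_5[of "- q"] by (simp add: G_qpoch_inf mult_ac flip: power_Suc)
  then have "theta_phi q = c * t 2 * t 4 * (s 1 * s 3 * r)\<^sup>2"
    using theta_phi_eq[OF norm_q q_nz] E_2 by (simp add: euler_E_eq_qpoch_inf)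
  moreover have "theta_phi (q ^ 5) = c * r\<^sup>2"
    using theta_phi_eq[of "q ^ 5"] norm_power_less[of 5] q_nz by (simp flip: power_mult)
  ultimately show ?thesis
    by (simp add: G_qpoch_inf power2_eq_square)
qed

end

section \<open>The Kronecker symbol of -20\<close>

definition chi4 :: "int \<Rightarrow> int" where
  "chi4 n = (if n mod 4 = 1 then 1 else if n mod 4 = 3 then -1 else 0)"

definition chi5 :: "int \<Rightarrow> int" where
  "chi5 n = (if n mod 5 = 1 \<or> n mod 5 = 4 then 1 else if n mod 5 = 0 then 0 else -1)"

lemma chi4_mult: "chi4 (a * b) = chi4 a * chi4 b"
proof -
  have "\<forall>x\<in>{0, 1, 2, 3}. \<forall>y\<in>{0, 1, 2, 3}. chi4 (x * y) = chi4 x * chi4 y"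
    by (simp add: chi4_def)
  moreover have "n mod 4 \<in> {0, 1, 2, 3}" for n :: int
    by simp presburger
  ultimately have "chi4 (a mod 4 * (b mod 4)) = chi4 (a mod 4) * chi4 (b mod 4)"
    by blast
  then show ?thesis
    unfolding chi4_def mod_mult_eq mod_mod_trivial .
qed

lemma chi5_mult: "chi5 (a * b) = chi5 a * chi5 b"
proof -
  have "\<forall>x\<in>{0, 1, 2, 3, 4}. \<forall>y\<in>{0, 1, 2, 3, 4}. chi5 (x * y) = chi5 x * chi5 y"
    by (simp add: chi5_def)
  moreover have "n mod 5 \<in> {0, 1, 2, 3, 4}" for n :: int
    by simp presburger
  ultimately have "chi5 (a mod 5 * (b mod 5)) = chi5 (a mod 5) * chi5 (b mod 5)"
    by blast
  then show ?thesis
    unfolding chi5_def mod_mult_eq mod_mod_trivial .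
qed

text \<open>From -20 = (-4) * 5: \<open>chi4\<close> is the character (-4/n), and
  \<open>chi5\<close> is (n/5).\<close>

definition chi20 :: "int \<Rightarrow> int" where
  "chi20 n = chi4 n * chi5 n"

lemma chi20_mult: "chi20 (a * b) = chi20 a * chi20 b"
  by (simp add: chi20_def chi4_mult chi5_mult)

lemma chi20_1 [simp]: "chi20 1 = 1"
  by (simp add: chi20_def chi4_def chi5_def)

lemma chi20_power: "chi20 (a ^ k) = chi20 a ^ k"
  by (induction k) (simp_all add: chi20_mult)

lemma chi20_prod: "chi20 (prod f A) = (\<Prod>x\<in>A. chi20 (f x))"
  by (induction A rule: infinite_finite_induct) (simp_all add: chi20_mult)

lemma QuadRes_5: "QuadRes 5 a \<longleftrightarrow> a mod 5 \<in> {0, 1, 4}"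
proof
  assume "QuadRes 5 a"
  then obtain y where y: "y\<^sup>2 mod 5 = a mod 5"
    by (auto simp: QuadRes_def cong_def)
  have "y mod 5 = 0 \<or> y mod 5 = 1 \<or> y mod 5 = 2 \<or> y mod 5 = 3 \<or> y mod 5 = 4"
    by presburger
  then have "(y mod 5)\<^sup>2 mod 5 \<in> {0, 1, 4}"
    by (elim disjE; simp only:) simp_all
  with y show "a mod 5 \<in> {0, 1, 4}"
    by (simp only: power_mod)
next
  assume "a mod 5 \<in> {0, 1, 4}"
  then have "[0\<^sup>2 = a] (mod 5) \<or> [1\<^sup>2 = a] (mod 5) \<or> [2\<^sup>2 = a] (mod 5)"
    by (auto simp: cong_def)
  then show "QuadRes 5 a"
    unfolding QuadRes_def by blast
qed

lemma Legendre_5: "Legendre a 5 = chi5 a"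
  by (auto simp: Legendre_def QuadRes_5 chi5_def cong_def)

lemma Legendre_cases: "Legendre a p \<in> {-1, 0, 1}"
  by (simp add: Legendre_def)

text \<open>Two such values differ by at most 2 < p. This upgrades the congruence of Euler's
  criterion to an equality.\<close>

lemma cong_small_eq:
  fixes a b p :: int
  assumes "[a = b] (mod p)" "2 < p" "a \<in> {-1, 0, 1}" "b \<in> {-1, 0, 1}"
  shows "a = b"
proof -
  have "p dvd a - b" using assms(1) by (simp add: cong_iff_dvd_diff)
  moreover have "\<bar>a - b\<bar> < p" using assms by auto
  ultimately show ?thesis using zdvd_imp_le[of p "\<bar>a - b\<bar>"] by force
qed

text \<open>In Euler's criterion (-20)^h = (-1)^h 4^h 5^h. Here 4^h = 2^(p-1) is 1 by Fermat, (-1)^h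
  is \<open>chi4\<close>, and reciprocity turns (5/p) into (p/5) without a sign because (5 - 1)/2 is
  even.\<close>

lemma Legendre_minus_20:
  assumes p: "prime p" "2 < p" "p \<noteq> 5"
  shows "Legendre (-20) (int p) = chi20 (int p)"
proof -
  define h where "h = (p - 1) div 2"
  have odd: "odd p" using p prime_odd_nat by simp
  have h: "p = 2 * h + 1" using odd p by (simp add: h_def)
  have euler: "[Legendre a (int p) = a ^ h] (mod int p)" for a
    unfolding h_def by (rule euler_criterion[OF p(1,2)])
  have "\<not> p dvd 2" using p by (auto dest: dvd_imp_le)
  then have "[2 ^ (p - 1) = 1] (mod p)"
    by (rule fermat_theorem[OF p(1)])
  then have "[int (2 ^ (p - 1)) = int 1] (mod int p)"
    by (simp only: cong_int_iff)
  then have four: "[4 ^ h = 1] (mod int p)"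
    using power_mult[of "2::int" 2 h] h by simp
  have "[Legendre (-20) (int p) = (-20) ^ h] (mod int p)"
    by (rule euler)
  also have "(-20) ^ h = (-1) ^ h * 4 ^ h * (5 :: int) ^ h"
    by (simp flip: power_mult_distrib)
  also have "[(-1) ^ h * 4 ^ h * 5 ^ h = (-1) ^ h * 1 * Legendre 5 (int p)] (mod int p)"
    by (intro cong_mult cong_refl four cong_sym[OF euler])
  finally have "[Legendre (-20) (int p) = (-1) ^ h * Legendre 5 (int p)] (mod int p)"
    by simp
  moreover have "(-1 :: int) ^ h \<in> {-1, 1}"
    by (cases "even h") auto
  ultimately have 1: "Legendre (-20) (int p) = (-1) ^ h * Legendre 5 (int p)"
    using p Legendre_cases[of "-20" p] Legendre_cases[of 5 p] by (intro cong_small_eq[of _ _ "int p"]) auto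
  have "Legendre (int p) (int 5) * Legendre (int 5) (int p) = (-1) ^ ((p - 1) div 2 * ((5 - 1) div 2))"
    using Quadratic_Reciprocity[of p 5] p by simp
  then have "Legendre (int p) 5 * Legendre 5 (int p) = 1"
    by (simp add: power_mult mult.commute[of _ 2])
  then have 2: "Legendre 5 (int p) = Legendre (int p) 5"
    using Legendre_cases[of 5 p] Legendre_cases[of p 5] by auto
  have "(-1) ^ h = chi4 (int p)"
  proof (cases "even h")
    case True
    then have "int p mod 4 = 1" using h by presburger
    with True show ?thesis by (simp add: chi4_def)
  next
    case False
    then have "int p mod 4 = 3" using h by presburger
    with False show ?thesis by (simp add: chi4_def)
  qed
  then show ?thesis
    by (simp add: 1 2 Legendre_5 chi20_def)
qed

lemma kronecker_prime_minus_20: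
  assumes "prime p"
  shows "kronecker_prime (-20) p = chi20 p"
proof -
  have "0 \<le> p" using prime_ge_2_int[OF assms] by simp
  then obtain p' where p: "p = int p'"
    using nonneg_int_cases by blast
  then have "prime p'" using assms by simp
  consider "p = 2" | "p = 5" | "2 < p" "p \<noteq> 5"
    using prime_ge_2_int[OF assms] by linarith
  then show ?thesis
  proof cases
    case 3
    then show ?thesis
      using Legendre_minus_20[OF \<open>prime p'\<close>] by (simp add: p kronecker_prime_def)
  \<comment> \<open>At 2 and at 5 both sides are 0.\<close>
  qed (simp_all add: kronecker_prime_def chi20_def chi4_def chi5_def Legendre_def cong_def)
qed

lemma kronecker_minus_20:
  assumes "n > 0"
  shows "kronecker (-20) n = chi20 n"
proof -
  have "kronecker (-20) n = (\<Prod>p\<in>prime_factors n. chi20 p ^ multiplicity p n)"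
  proof -
    have "kronecker_prime (-20) p = chi20 p" if "p \<in> prime_factors n" for p
      using that by (intro kronecker_prime_minus_20) (rule in_prime_factors_imp_prime)
    then show ?thesis
      using assms by (simp add: kronecker_def)
  qed
  also have "\<dots> = chi20 (\<Prod>p\<in>prime_factors n. p ^ multiplicity p n)"
    by (simp add: chi20_prod chi20_power)
  also have "(\<Prod>p\<in>prime_factors n. p ^ multiplicity p n) = n"
    using assms prod_prime_factors[of n] by simp
  finally show ?thesis .
qed

section \<open>Lambert series\<close>

text \<open>The terms at n and -n are paired; the term at 0 has no partner and is
  subtracted.\<close>

lemma has_sum_int_fold:
  fixes f :: "int \<Rightarrow> 'a :: banach"
  assumes "(f has_sum S) UNIV"
  shows "((\<lambda>n::nat. f (int n) + f (- int n)) has_sum (S - f 0)) {1..}"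
proof -
  have summ: "f summable_on A" for A
    using summable_on_subset_banach[OF has_sum_imp_summable[OF assms], of A] by simp
  have pos: "((\<lambda>n::nat. f (int n)) has_sum infsum f {1..}) {1..}"
    using has_sum_infsum[OF summ[of "{1..}"]]
    by (subst has_sum_reindex_bij_witness[where T = "{1..}" and i = nat and j = int and h = f]) auto
  have neg: "((\<lambda>n::nat. f (- int n)) has_sum infsum f {..-1}) {1..}"
    using has_sum_infsum[OF summ[of "{..-1}"]]
    by (subst has_sum_reindex_bij_witness[where T = "{..-1}" and i = "\<lambda>n. nat (- n)" and j = "\<lambda>n. - int n" and h = f]) auto
  have "(f has_sum infsum f {1..} + infsum f {..-1}) ({1..} \<union> {..-1})"
    by (rule has_sum_Un_disjoint) (use summ in auto)
  from has_sum_insert[OF _ this, of 0] have "(f has_sum f 0 + (infsum f {1..} + infsum f {..-1})) (insert 0 ({1..} \<union> {..-1}))"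
    by simp
  moreover have "insert 0 ({1..} \<union> {..-1}) = (UNIV :: int set)"
    by auto
  ultimately have "S = f 0 + (infsum f {1..} + infsum f {..-1})"
    using has_sum_unique[OF assms] by simp
  then show ?thesis
    using has_sum_add[OF pos neg] by simp
qed

lemma chi20_cases: "chi20 n \<in> {-1, 0, 1}"
  by (simp add: chi20_def chi4_def chi5_def)

text \<open>Adding 10 exchanges the residues 1 and 3 modulo 4 and fixes those modulo 5.\<close>

lemma chi20_add_10: "chi20 (n + 10) = - chi20 n"
proof -
  have "(n + 10) mod 4 = 1 \<longleftrightarrow> n mod 4 = 3" "(n + 10) mod 4 = 3 \<longleftrightarrow> n mod 4 = 1"
    "(n + 10) mod 5 = n mod 5"
    by presburger+
  then have "chi4 (n + 10) = - chi4 n" "chi5 (n + 10) = chi5 n"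
    unfolding chi4_def chi5_def by simp_all
  then show ?thesis
    by (simp add: chi20_def)
qed

text \<open>Antiperiodicity gives f = P - x^10 f for the sum f, where P collects the indices below
  10. Only 1, 3, 7 and 9 contribute, each with value 1.\<close>

lemma chi20_power_series:
  fixes x :: complex
  assumes x: "norm x < 1"
  shows "((\<lambda>n::nat. of_int (chi20 (int n)) * x ^ n) has_sum ((x + x ^ 3 + x ^ 7 + x ^ 9) / (1 + x ^ 10))) {1..}"
proof -
  define f :: "nat \<Rightarrow> complex" where "f n = of_int (chi20 (int n)) * x ^ n" for n
  have bound: "norm (f n) \<le> norm x ^ n" for n
    using chi20_cases[of "int n"] by (auto simp: f_def norm_power)
  have "summable (\<lambda>n. norm x ^ n)"
    using x by (intro summable_geometric) auto
  then have summ: "summable (\<lambda>n. norm (f n))"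
    by (rule summable_comparison_test'[of _ 0]) (simp add: bound)
  then have "summable f"
    by (rule summable_norm_cancel)
  then have "suminf f = (\<Sum>n. f (n + 10)) + (\<Sum>n<10. f n)"
    by (rule suminf_split_initial_segment)
  also have "(\<Sum>n. f (n + 10)) = (\<Sum>n. (- (x ^ 10)) * f n)"
    using chi20_add_10 by (simp add: f_def power_add mult_ac add.commute)
  also have "\<dots> = (- (x ^ 10)) * suminf f"
    by (rule suminf_mult[OF \<open>summable f\<close>])
  also have "(\<Sum>n<10. f n) = x + x ^ 3 + x ^ 7 + x ^ 9"
    by (simp add: f_def lessThan_nat_numeral lessThan_Suc chi20_def chi4_def chi5_def)
  finally have "suminf f * (1 + x ^ 10) = x + x ^ 3 + x ^ 7 + x ^ 9"
    by (simp add: algebra_simps)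
  moreover have "1 + x ^ 10 \<noteq> 0"
  proof
    assume "1 + x ^ 10 = 0"
    then have "norm (x ^ 10) = 1"
      by (metis add_eq_0_iff norm_minus_cancel norm_one)
    moreover have "norm x ^ 10 < 1"
      using x by (simp add: power_less_one_iff)
    ultimately show False
      by (simp add: norm_power)
  qed
  ultimately have "suminf f = (x + x ^ 3 + x ^ 7 + x ^ 9) / (1 + x ^ 10)"
    by (simp add: eq_divide_eq)
  then have "(f has_sum ((x + x ^ 3 + x ^ 7 + x ^ 9) / (1 + x ^ 10))) UNIV"
    using norm_summable_imp_has_sum[OF summ] \<open>summable f\<close> by (metis summable_sums)
  also have "?this \<longleftrightarrow> (f has_sum ((x + x ^ 3 + x ^ 7 + x ^ 9) / (1 + x ^ 10))) {1..}"
    by (rule has_sum_cong_neutral) (auto simp: f_def chi20_def chi4_def not_le)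
  finally show ?thesis
    unfolding f_def .
qed

text \<open>Comparison with a double geometric series. It justifies exchanging the order of
  summation in \<open>has_sum_lambert_chi20\<close>.\<close>

lemma lambert_double_summable:
  fixes q :: complex and h :: "nat \<Rightarrow> complex"
  assumes q: "norm q < 1" and h: "\<And>m. norm (h m) \<le> 1"
  shows "(\<lambda>(m, n). h m * q ^ (m * n)) summable_on {1..} \<times> {1..}"
proof -
  have pow: "norm q ^ m < 1" if "m \<in> {1..}" for m :: nat
    using q that by (simp add: power_less_one_iff)
  have "(\<lambda>(m, n). (norm q ^ m) ^ n) summable_on {1..} \<times> {1 :: nat..}"
  proof (rule summable_on_SigmaI)
    show "((\<lambda>n. case (m, n) of (m, n) \<Rightarrow> (norm q ^ m) ^ n) has_sum norm q ^ m / (1 - norm q ^ m)) {1..}"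
      if "m \<in> {1..}" for m
      using has_sum_geometric_from_1[of "norm q ^ m"] pow[OF that] by simp
    have "(\<lambda>m. norm q ^ m) summable_on {1..}"
      using has_sum_geometric_from_1[of "norm q"] q by (auto intro: has_sum_imp_summable)
    then have "(\<lambda>m. norm q ^ m * (1 / (1 - norm q))) summable_on {1..}"
      by (rule summable_on_cmult_left)
    then show "(\<lambda>m. norm q ^ m / (1 - norm q ^ m)) summable_on {1..}"
    proof (rule summable_on_comparison_test)
      fix m :: nat assume m: "m \<in> {1..}"
      have "norm q ^ m \<le> norm q"
        using power_decreasing[of 1 m "norm q"] m q by simp
      then show "norm q ^ m / (1 - norm q ^ m) \<le> norm q ^ m * (1 / (1 - norm q))"
        using q pow[OF m] by (simp add: frac_le)
      show "0 \<le> norm q ^ m / (1 - norm q ^ m)"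
        using pow[OF m] by simp
    qed
  qed auto
  then have "(\<lambda>p. norm (case p of (m, n) \<Rightarrow> h m * q ^ (m * n))) summable_on {1..} \<times> {1..}"
  proof (rule summable_on_comparison_test)
    fix p :: "nat \<times> nat"
    show "norm (case p of (m, n) \<Rightarrow> h m * q ^ (m * n)) \<le> (case p of (m, n) \<Rightarrow> (norm q ^ m) ^ n)"
      using h mult_right_mono[OF h, of "norm q ^ (fst p * snd p)"]
      by (auto simp: norm_mult norm_power power_mult split: prod.splits)
  qed auto
  then show ?thesis
    by (rule abs_summable_summable)
qed

section \<open>Bilateral sums and Lambert series as theta quotients\<close>

context level_ten
begin

text \<open>Kronecker's formula in base q^10 at a = -q^m and z = q^j; the range of \<open>j\<close>
  is the annulus condition on \<open>z\<close>.\<close>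

lemma lambert_has_sum:
  assumes "0 < j" "j < 10"
  shows "((\<lambda>n. q powi (int j * n) / (1 + q powi (10 * n + m))) has_sum
    c\<^sup>2 * s (m + int j) / (s m * t (int j))) UNIV"
proof -
  have "norm (q ^ 10) < norm (q ^ j)"
    using assms norm_q q_nz by (simp add: norm_power power_strict_decreasing)
  moreover have "norm (q ^ j) < 1"
    using assms by (simp add: norm_power_less)
  moreover have shift: "- (q powi m) * (q ^ 10) powi i = - (q powi (10 * i + m))" for i
    unfolding base_powi using q_nz by (simp add: power_int_add mult.commute)
  moreover have "(q ^ j) powi n = q powi (int j * n)" for n
    by (simp add: power_int_mult)
  moreover have "- (q powi m) * q ^ j = - (q powi (m + int j))"
    using q_nz by (simp add: power_int_add)
  ultimately show ?thesis
    using kronecker_sum[OF base, of "- (q powi m)" "q ^ j"] q_nz minus_powi_neq_1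
    by (simp add: G_def)
qed

lemma has_sum_bilateral_1: "((\<lambda>n. q powi n / (1 + q powi (10 * n))) has_sum c\<^sup>2 * s 1 / (s 0 * t 1)) UNIV"
  using lambert_has_sum[of 1 0] by simp

lemma has_sum_bilateral_3: "((\<lambda>n. q powi (3 * n) / (1 + q powi (10 * n))) has_sum c\<^sup>2 * s 3 / (s 0 * t 3)) UNIV"
  using lambert_has_sum[of 3 0] by simp

text \<open>The numerator index 4 + 5 = 9 reflects to 1; in \<open>has_sum_bilateral_4\<close>, 2 +
  5 = 7 reflects to 3.\<close>

lemma has_sum_bilateral_2: "((\<lambda>n. q powi (5 * n + 2) / (1 + q powi (10 * n + 4))) has_sum
    q\<^sup>2 * (c\<^sup>2 * s 1 / (s 4 * t 5))) UNIV"
  using has_sum_cmult_right[OF lambert_has_sum[of 5 4], of "q\<^sup>2"] q_nz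
  by (simp add: G_reduce power_int_add mult.commute)

lemma has_sum_bilateral_4: "((\<lambda>n. q powi (5 * n + 1) / (1 + q powi (10 * n + 2))) has_sum
    q * (c\<^sup>2 * s 3 / (s 2 * t 5))) UNIV"
  using has_sum_cmult_right[OF lambert_has_sum[of 5 2], of "q"] q_nz
  by (simp add: G_reduce power_int_add mult.commute)

lemma t_nonzero: "t 1 \<noteq> 0" "t 2 \<noteq> 0" "t 3 \<noteq> 0" "t 4 \<noteq> 0" "t 5 \<noteq> 0"
  by (simp_all add: G_nonzero)

lemma s_nonzero: "s k \<noteq> 0"
  by (simp add: G_nonzero)

lemmas nonzero = t_nonzero s_nonzero qpoch_infs_nonzero

text \<open>The two Euler relations trade surplus theta factors for the common denominator of the
  four bilateral sums; the second one, \<open>s_0_s_5_t_5\<close>, supplies the 2.\<close>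

lemma phi_phi_quotient:
  "theta_phi q * theta_phi (q ^ 5) =
    2 * c\<^sup>2 * (s 1 * s 3 * s 5 * t 2 * t 4) / (t 1 * t 3 * t 5 * s 0 * s 2 * s 4)"
proof -
  have "theta_phi q * theta_phi (q ^ 5) * (t 1 * t 3 * t 5 * s 0 * s 2 * s 4) =
      c\<^sup>2 * (s 1 * s 3 * s 5 * t 2 * t 4) * (t 1 * t 3 * s 1 * s 2 * s 3 * s 4) * (t 5 * s 5 * s 0)"
    unfolding phi_phi power2_eq_square by (simp only: mult_ac)
  also have "\<dots> = 2 * c\<^sup>2 * (s 1 * s 3 * s 5 * t 2 * t 4)"
    unfolding euler_relation s_0_s_5_t_5 by simp
  finally show ?thesis
    using nonzero by (simp add: eq_divide_eq)
qed

lemma phi_phi_A: "theta_phi q * theta_phi (q ^ 5) =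
    2 * (c\<^sup>2 * s 1 / (s 0 * t 1) - q\<^sup>2 * (c\<^sup>2 * s 1 / (s 4 * t 5)))"
proof -
  have "2 * (c\<^sup>2 * s 1 / (s 0 * t 1) - q\<^sup>2 * (c\<^sup>2 * s 1 / (s 4 * t 5))) =
      2 * c\<^sup>2 * s 1 * (s 4 * s 2 * t 5 * t 3 - q\<^sup>2 * (s 2 * s 0 * t 3 * t 1)) / (t 1 * t 3 * t 5 * s 0 * s 2 * s 4)"
    using nonzero by (simp add: field_simps)
  also have "s 4 * s 2 * t 5 * t 3 - q\<^sup>2 * (s 2 * s 0 * t 3 * t 1) = t 4 * t 2 * s 5 * s 3"
    using relation_A by (simp add: algebra_simps)
  finally show ?thesis
    unfolding phi_phi_quotient by (simp add: mult_ac)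
qed

lemma phi_phi_B: "theta_phi q * theta_phi (q ^ 5) =
    2 * (c\<^sup>2 * s 3 / (s 0 * t 3) + q * (c\<^sup>2 * s 3 / (s 2 * t 5)))"
proof -
  have "2 * (c\<^sup>2 * s 3 / (s 0 * t 3) + q * (c\<^sup>2 * s 3 / (s 2 * t 5))) =
      2 * c\<^sup>2 * s 3 * (s 4 * s 2 * t 5 * t 1 + q * (s 4 * s 0 * t 3 * t 1)) / (t 1 * t 3 * t 5 * s 0 * s 2 * s 4)"
    using nonzero by (simp add: field_simps)
  also have "s 4 * s 2 * t 5 * t 1 + q * (s 4 * s 0 * t 3 * t 1) = t 4 * t 2 * s 5 * s 1"
    using relation_B by (simp add: algebra_simps)
  finally show ?thesis
    unfolding phi_phi_quotient by (simp add: mult_ac)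
qed

lemma eta_D: "c\<^sup>2 * s 1 / (s 0 * t 1) + c\<^sup>2 * s 3 / (s 0 * t 3) =
    euler_E (q ^ 2) * euler_E (q ^ 4) * euler_E (q ^ 5) * euler_E (q ^ 10) / (euler_E q * euler_E (q ^ 20))"
proof -
  have "c\<^sup>2 * s 1 / (s 0 * t 1) + c\<^sup>2 * s 3 / (s 0 * t 3) =
      c\<^sup>2 * (s 1 * t 3 + t 1 * s 3) / (s 0 * t 1 * t 3)"
    using nonzero by (simp add: field_simps)
  also have "\<dots> = c\<^sup>2 * (t 2 * t 4 * s 2 * s 4) / (t 1 * t 3)"
    unfolding relation_D using nonzero by simp
  also have "\<dots> = euler_E (q ^ 2) * euler_E (q ^ 4) * euler_E (q ^ 5) * euler_E (q ^ 10) / (euler_E q * euler_E (q ^ 20))"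
    unfolding E_1 E_2 E_4 E_5 E_10 E_20 using nonzero by (simp add: field_simps power2_eq_square)
  finally show ?thesis .
qed

lemma eta_E: "q * (c\<^sup>2 * s 3 / (s 2 * t 5)) - q\<^sup>2 * (c\<^sup>2 * s 1 / (s 4 * t 5)) =
    q * (euler_E q * euler_E (q ^ 2) * euler_E (q ^ 10) * euler_E (q ^ 20) / (euler_E (q ^ 4) * euler_E (q ^ 5)))"
proof -
  \<comment> \<open>Subtracting \<open>relation_E2\<close> from \<open>relation_E1\<close> removes
    \<open>s 4 * s 2 * s 1 * s 3\<close> and doubles the product of \<open>t 1\<close> to
    \<open>t 4\<close>. The factor on the left equals 2, so both twos cancel.\<close>
  have "(t 5 * s 5 * s 0) * (s 3 * s 4 - q * (s 1 * s 2)) =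
      t 5 * (s 3 * s 5 * s 4 * s 0 - q * (s 1 * s 5 * s 2 * s 0))"
    by (simp add: algebra_simps)
  also have "\<dots> = t 5 * (2 * (t 1 * t 2 * t 3 * t 4))"
    unfolding relation_E2 using relation_E1 by (simp add: algebra_simps)
  finally have "2 * (s 3 * s 4 - q * (s 1 * s 2)) = 2 * (t 1 * t 2 * t 3 * t 4 * t 5)"
    unfolding s_0_s_5_t_5 by (simp only: mult_ac)
  then have rel: "s 3 * s 4 - q * (s 1 * s 2) = t 1 * t 2 * t 3 * t 4 * t 5"
    by (rule mult_left_cancel[THEN iffD1, rotated]) simp
  have "q * (c\<^sup>2 * s 3 / (s 2 * t 5)) - q\<^sup>2 * (c\<^sup>2 * s 1 / (s 4 * t 5)) =
      q * (c\<^sup>2 * (s 3 * s 4 - q * (s 1 * s 2)) / (s 2 * s 4 * t 5))"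
    using nonzero by (simp add: field_simps power2_eq_square)
  also have "\<dots> = q * (c\<^sup>2 * (t 1 * t 2 * t 3 * t 4) / (s 2 * s 4))"
    unfolding rel using nonzero by simp
  also have "\<dots> = q * (euler_E q * euler_E (q ^ 2) * euler_E (q ^ 10) * euler_E (q ^ 20) / (euler_E (q ^ 4) * euler_E (q ^ 5)))"
    unfolding E_1 E_2 E_4 E_5 E_10 E_20 using nonzero by (simp add: field_simps power2_eq_square)
  finally show ?thesis .
qed

text \<open>Expand q^m / (1 - q^m) geometrically and sum over \<open>m\<close> first. With x = q^n
  each column is a fraction over 1 + x^10 whose numerator splits into x + x^3 and x^9 + x^7: these
  are the terms at n and -n of the first plus the third bilateral sum. The terms at 0 add up to
  1.\<close>

lemma has_sum_lambert_chi20: "((\<lambda>n::nat. of_int (chi20 (int n)) * (q ^ n / (1 - q ^ n))) has_sum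
    c\<^sup>2 * s 1 / (s 0 * t 1) + c\<^sup>2 * s 3 / (s 0 * t 3) - 1) {1..}"
proof -
  define S where "S = c\<^sup>2 * s 1 / (s 0 * t 1) + c\<^sup>2 * s 3 / (s 0 * t 3)"
  define F :: "nat \<times> nat \<Rightarrow> complex" where "F = (\<lambda>(m, n). of_int (chi20 (int m)) * q ^ (m * n))"
  have "F summable_on {1..} \<times> {1..}"
    unfolding F_def
  proof (rule lambert_double_summable[OF norm_q])
    show "norm (of_int (chi20 (int m)) :: complex) \<le> 1" for m
      using chi20_cases[of "int m"] by auto
  qed
  then obtain X where X: "(F has_sum X) ({1..} \<times> {1..})"
    by (auto simp: summable_on_def)
  have rows: "((\<lambda>m. of_int (chi20 (int m)) * (q ^ m / (1 - q ^ m))) has_sum X) {1..}"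
  proof (rule has_sum_SigmaD[OF X])
    fix m :: nat assume "m \<in> {1..}"
    then have "norm (q ^ m) < 1"
      by (simp add: norm_power_less)
    from has_sum_cmult_right[OF has_sum_geometric_from_1[OF this]]
    show "((\<lambda>n. F (m, n)) has_sum of_int (chi20 (int m)) * (q ^ m / (1 - q ^ m))) {1..}"
      by (simp add: F_def power_mult)
  qed
  have columns: "((\<lambda>n. (q ^ n + (q ^ n) ^ 3 + (q ^ n) ^ 7 + (q ^ n) ^ 9) / (1 + (q ^ n) ^ 10)) has_sum X) {1..}"
  proof (rule has_sum_SigmaD[OF has_sum_swap[THEN iffD1, OF X]])
    fix n :: nat assume "n \<in> {1..}"
    then have "norm (q ^ n) < 1"
      by (simp add: norm_power_less)
    from chi20_power_series[OF this]
    show "((\<lambda>m. case (n, m) of (n, m) \<Rightarrow> F (m, n)) has_sum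
        (q ^ n + (q ^ n) ^ 3 + (q ^ n) ^ 7 + (q ^ n) ^ 9) / (1 + (q ^ n) ^ 10)) {1..}"
      by (simp add: F_def power_mult[symmetric] mult.commute)
  qed
  define f where "f n = q powi n / (1 + q powi (10 * n)) + q powi (3 * n) / (1 + q powi (10 * n))" for n
  have fold: "f (int n) + f (- int n) = (q ^ n + (q ^ n) ^ 3 + (q ^ n) ^ 7 + (q ^ n) ^ 9) / (1 + (q ^ n) ^ 10)" for n
  proof -
    define x where "x = q ^ n"
    have pw: "q powi (int j * int n) = x ^ j" for j
      unfolding of_nat_mult[symmetric] power_int_of_nat x_def by (simp add: power_mult[symmetric] mult.commute)
    have pw': "q powi int n = x" "q powi (3 * int n) = x ^ 3" "q powi (10 * int n) = x ^ 10"
      using pw[of 1] pw[of 3] pw[of 10] by simp_all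
    have "- (x ^ 10) \<noteq> 1"
      using minus_powi_neq_1[of "10 * int n"] unfolding pw' .
    moreover have "- (x ^ 10) = 1" if "1 + x ^ 10 = 0"
      using that by (simp add: add_eq_0_iff)
    ultimately have x: "x \<noteq> 0" "1 + x ^ 10 \<noteq> 0"
      using q_nz by (auto simp: x_def)
    have "f (int n) = (x + x ^ 3) / (1 + x ^ 10)"
      unfolding f_def pw' by (simp add: add_divide_distrib)
    moreover have "f (- int n) = (x ^ 9 + x ^ 7) / (1 + x ^ 10)"
    proof -
      have "f (- int n) = (inverse x + inverse x ^ 3) / (1 + inverse x ^ 10)"
        unfolding f_def mult_minus_right power_int_minus pw' by (simp add: add_divide_distrib power_inverse)
      also have "\<dots> = (x ^ 10 * (inverse x + inverse x ^ 3)) / (x ^ 10 * (1 + inverse x ^ 10))"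
        using x by simp
      also have "x ^ 10 * (inverse x + inverse x ^ 3) = x ^ 9 + x ^ 7"
        using x by (simp add: field_simps eval_nat_numeral)
      also have "x ^ 10 * (1 + inverse x ^ 10) = 1 + x ^ 10"
        using x by (simp add: distrib_left power_inverse)
      finally show ?thesis .
    qed
    ultimately show ?thesis
      by (simp add: x_def add_divide_distrib)
  qed
  have "(f has_sum S) UNIV"
    unfolding f_def S_def by (rule has_sum_add[OF has_sum_bilateral_1 has_sum_bilateral_3])
  from has_sum_int_fold[OF this]
  have "((\<lambda>n. (q ^ n + (q ^ n) ^ 3 + (q ^ n) ^ 7 + (q ^ n) ^ 9) / (1 + (q ^ n) ^ 10)) has_sum S - 1) {1..}"
    unfolding fold by (simp add: f_def)
  with columns have "X = S - 1"
    by (rule has_sum_unique)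
  then show ?thesis
    using rows by (simp add: S_def)
qed

lemma has_sum_lambert_chi5: "((\<lambda>n::nat. of_int (chi5 (int n)) * (q ^ n / (1 + q ^ (2 * n)))) has_sum
    q * (c\<^sup>2 * s 3 / (s 2 * t 5)) - q\<^sup>2 * (c\<^sup>2 * s 1 / (s 4 * t 5))) {1..}"
proof -
  define g where "g k = q powi k / (1 + q powi (2 * k))" for k
  have g_minus: "g (- k) = g k" for k
  proof -
    have "1 + q powi (2 * k) \<noteq> 0"
      using minus_powi_neq_1[of "2 * k"] by (metis add_eq_0_iff minus_minus)
    moreover have "q powi (2 * k) = q powi k * q powi k"
      using q_nz by (simp flip: power_int_add)
    moreover have "q powi k \<noteq> 0"
      using q_nz by simp
    ultimately show ?thesis
      by (simp add: g_def power_int_minus field_simps)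
  qed
  have div_mod: "5 * (k div 5) + e = k" if "k mod 5 = e" for k e :: int
    using mult_div_mod_eq[of 5 k] that by simp
  \<comment> \<open>Extending each residue class by zero puts both sums over the same index set, so
    that they can be subtracted termwise.\<close>
  have restrict: "((\<lambda>k. if k mod 5 = e then g k else 0) has_sum S) UNIV"
    if "((\<lambda>n. g (5 * n + e)) has_sum S) UNIV" "e = 1 \<or> e = 2" for S e
  proof -
    have "((\<lambda>n. g (5 * n + e)) has_sum S) UNIV \<longleftrightarrow> (g has_sum S) {k. k mod 5 = e}"
      by (rule has_sum_reindex_bij_witness[where i = "\<lambda>k. k div 5" and j = "\<lambda>n. 5 * n + e"])
        (use that(2) in \<open>auto intro: div_mod\<close>)
    also have "\<dots> \<longleftrightarrow> ((\<lambda>k. if k mod 5 = e then g k else 0) has_sum S) UNIV"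
      by (rule has_sum_cong_neutral) auto
    finally show ?thesis
      using that(1) by simp
  qed
  define h where "h k = (if k mod 5 = 1 then g k else 0) - (if k mod 5 = 2 then g k else 0)" for k
  let ?S = "q * (c\<^sup>2 * s 3 / (s 2 * t 5)) - q\<^sup>2 * (c\<^sup>2 * s 1 / (s 4 * t 5))"
  have "((\<lambda>n. g (5 * n + 1)) has_sum q * (c\<^sup>2 * s 3 / (s 2 * t 5))) UNIV"
    using has_sum_bilateral_4 by (simp add: g_def distrib_left)
  moreover have "((\<lambda>n. g (5 * n + 2)) has_sum q\<^sup>2 * (c\<^sup>2 * s 1 / (s 4 * t 5))) UNIV"
    using has_sum_bilateral_2 by (simp add: g_def distrib_left)
  ultimately have "(h has_sum ?S) UNIV"
    unfolding h_def diff_conv_add_uminus[of "if _ then _ else _"] diff_conv_add_uminus[of "q * _"]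
    by (intro has_sum_add has_sum_uminusI restrict) auto
  \<comment> \<open>The subtracted term \<open>h 0\<close> is 0, because 0 lies in neither residue
    class.\<close>
  from has_sum_int_fold[OF this]
  have "((\<lambda>n. h (int n) + h (- int n)) has_sum ?S) {1..}"
    by (simp add: h_def)
  moreover have "h (int n) + h (- int n) = of_int (chi5 (int n)) * (q ^ n / (1 + q ^ (2 * n)))" for n
  proof -
    have "g (int n) = q ^ n / (1 + q ^ (2 * n))"
      using power_int_of_nat[of q "2 * n"] by (simp add: g_def)
    moreover have "int n mod 5 = 0 \<or> int n mod 5 = 1 \<or> int n mod 5 = 2 \<or> int n mod 5 = 3 \<or> int n mod 5 = 4"
      by presburger
    moreover have "(- int n) mod 5 = (if int n mod 5 = 0 then 0 else 5 - int n mod 5)"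
      by (simp add: zmod_zminus1_eq_if)
    ultimately show ?thesis
      by (auto simp: h_def chi5_def g_minus)
  qed
  ultimately show ?thesis
    by simp
qed

end

section \<open>Assembly, with q = 0 as a separate case\<close>

lemma has_sum_at_zero:
  fixes f :: "int \<Rightarrow> complex"
  assumes "\<And>n. n \<noteq> 0 \<Longrightarrow> f n = 0"
  shows "(f has_sum f 0) UNIV"
  by (rule has_sum_finite_neutralI[of "{0}"]) (use assms in auto)

lemma euler_E_0: "euler_E 0 = 1"
  by (simp add: euler_E_def)

theorem theorem3p1:
  fixes q :: complex
  assumes "norm q < 1"
  shows
    "((\<lambda>n::int. q powi n / (1 + q powi (10 * n))) summable_on UNIV) \<and>
     ((\<lambda>n::int. q powi (5 * n + 2) / (1 + q powi (10 * n + 4))) summable_on UNIV) \<and>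
     ((\<lambda>n::int. q powi (3 * n) / (1 + q powi (10 * n))) summable_on UNIV) \<and>
     ((\<lambda>n::int. q powi (5 * n + 1) / (1 + q powi (10 * n + 2))) summable_on UNIV) \<and>
     ((\<lambda>n::nat. of_int (kronecker (-20) (int n)) * (q ^ n / (1 - q ^ n))) summable_on {1..}) \<and>
     ((\<lambda>n::nat. of_int (Legendre (int n) 5) * (q ^ n / (1 + q ^ (2 * n)))) summable_on {1..}) \<and>
     (theta_phi q * theta_phi (q ^ 5) =
       2 * ((\<Sum>\<^sub>\<infinity>n\<in>(UNIV :: int set). q powi n / (1 + q powi (10 * n)))
          - (\<Sum>\<^sub>\<infinity>n\<in>(UNIV :: int set). q powi (5 * n + 2) / (1 + q powi (10 * n + 4))))) \<and>
     (theta_phi q * theta_phi (q ^ 5) =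
       2 * ((\<Sum>\<^sub>\<infinity>n\<in>(UNIV :: int set). q powi (3 * n) / (1 + q powi (10 * n)))
          + (\<Sum>\<^sub>\<infinity>n\<in>(UNIV :: int set). q powi (5 * n + 1) / (1 + q powi (10 * n + 2))))) \<and>
     (theta_phi q * theta_phi (q ^ 5) =
       1 + (\<Sum>\<^sub>\<infinity>n\<in>{1 :: nat..}. of_int (kronecker (-20) (int n)) * (q ^ n / (1 - q ^ n)))
         + (\<Sum>\<^sub>\<infinity>n\<in>{1 :: nat..}. of_int (Legendre (int n) 5) * (q ^ n / (1 + q ^ (2 * n))))) \<and>
     (1 + (\<Sum>\<^sub>\<infinity>n\<in>{1 :: nat..}. of_int (kronecker (-20) (int n)) * (q ^ n / (1 - q ^ n))) =
       euler_E (q ^ 2) * euler_E (q ^ 4) * euler_E (q ^ 5) * euler_E (q ^ 10)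
         / (euler_E q * euler_E (q ^ 20))) \<and>
     ((\<Sum>\<^sub>\<infinity>n\<in>{1 :: nat..}. of_int (Legendre (int n) 5) * (q ^ n / (1 + q ^ (2 * n)))) =
       q * (euler_E q * euler_E (q ^ 2) * euler_E (q ^ 10) * euler_E (q ^ 20)
         / (euler_E (q ^ 4) * euler_E (q ^ 5))))"
proof (cases "q = 0")
  case True
  \<comment> \<open>By convention negative powers of 0 are 0, which agrees with the limits of the
    summands as q tends to 0. Only n = 0 contributes: 1/2 to the first and third sums, nothing to
    the second and fourth.\<close>
  have zero: "(0 :: complex) powi m = 0" if "m \<noteq> 0" for m
    using that by (simp add: power_int_0_left_if)
  have 1: "((\<lambda>n::int. (0 :: complex) powi n / (1 + 0 powi (10 * n))) has_sum (1 / 2)) UNIV"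
    using has_sum_at_zero[of "\<lambda>n::int. (0 :: complex) powi n / (1 + 0 powi (10 * n))"] by (simp add: zero)
  have 3: "((\<lambda>n::int. (0 :: complex) powi (3 * n) / (1 + 0 powi (10 * n))) has_sum (1 / 2)) UNIV"
    using has_sum_at_zero[of "\<lambda>n::int. (0 :: complex) powi (3 * n) / (1 + 0 powi (10 * n))"] by (simp add: zero)
  have "5 * n + 2 \<noteq> 0" "5 * n + 1 \<noteq> 0" for n :: int
    by presburger+
  then have 24: "(0 :: complex) powi (5 * n + 2) = 0" "(0 :: complex) powi (5 * n + 1) = 0" for n
    by (simp_all add: zero)
  have phi: "theta_phi 0 = 1"
    unfolding theta_phi_def
    by (rule infsumI) (use has_sum_at_zero[of "\<lambda>n::int. (0 :: complex) powi (n ^ 2)"] in \<open>simp add: zero\<close>)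
  have L: "((\<lambda>n::nat. c n * (0 ^ n / d n)) has_sum 0) {1..}" for c d :: "nat \<Rightarrow> complex"
    by (rule has_sum_0) auto
  show ?thesis
    unfolding True 24
    using 1 3 L[of "\<lambda>n. of_int (kronecker (-20) (int n))" "\<lambda>n. 1 - 0 ^ n"]
      L[of "\<lambda>n. of_int (Legendre (int n) 5)" "\<lambda>n. 1 + 0 ^ (2 * n)"]
    by (simp add: has_sum_iff phi euler_E_0 mult.commute[of _ 2])
next
  case False
  interpret level_ten q
    by unfold_locales (use assms False in auto)
  have "((\<lambda>n::nat. of_int (kronecker (-20) (int n)) * (q ^ n / (1 - q ^ n))) has_sum
      c\<^sup>2 * s 1 / (s 0 * t 1) + c\<^sup>2 * s 3 / (s 0 * t 3) - 1) {1..}"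
    by (rule has_sum_cong[THEN iffD1, OF _ has_sum_lambert_chi20]) (simp add: kronecker_minus_20)
  moreover have "((\<lambda>n::nat. of_int (Legendre (int n) 5) * (q ^ n / (1 + q ^ (2 * n)))) has_sum
      q * (c\<^sup>2 * s 3 / (s 2 * t 5)) - q\<^sup>2 * (c\<^sup>2 * s 1 / (s 4 * t 5))) {1..}"
    unfolding Legendre_5 by (rule has_sum_lambert_chi5)
  ultimately have L: "(\<lambda>n::nat. of_int (kronecker (-20) (int n)) * (q ^ n / (1 - q ^ n))) summable_on {1..}"
    "(\<Sum>\<^sub>\<infinity>n\<in>{1 :: nat..}. of_int (kronecker (-20) (int n)) * (q ^ n / (1 - q ^ n))) =
      c\<^sup>2 * s 1 / (s 0 * t 1) + c\<^sup>2 * s 3 / (s 0 * t 3) - 1"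
    "(\<lambda>n::nat. of_int (Legendre (int n) 5) * (q ^ n / (1 + q ^ (2 * n)))) summable_on {1..}"
    "(\<Sum>\<^sub>\<infinity>n\<in>{1 :: nat..}. of_int (Legendre (int n) 5) * (q ^ n / (1 + q ^ (2 * n)))) =
      q * (c\<^sup>2 * s 3 / (s 2 * t 5)) - q\<^sup>2 * (c\<^sup>2 * s 1 / (s 4 * t 5))"
    unfolding has_sum_iff by blast+
  have phi_phi_C: "theta_phi q * theta_phi (q ^ 5) =
      1 + (c\<^sup>2 * s 1 / (s 0 * t 1) + c\<^sup>2 * s 3 / (s 0 * t 3) - 1)
        + (q * (c\<^sup>2 * s 3 / (s 2 * t 5)) - q\<^sup>2 * (c\<^sup>2 * s 1 / (s 4 * t 5)))"
  proof -
    have average: "x = 1 + (a + b - 1) + (e - f)" if "x = 2 * (a - f)" "x = 2 * (b + e)"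
      for x a b e f :: complex
    proof -
      have "2 * (b + e) = 2 * (a - f)" using that by metis
      then have "b + e = a - f" by (rule mult_left_cancel[THEN iffD1, rotated]) simp
      have "1 + (a + b - 1) + (e - f) = (a - f) + (b + e)" by simp
      also note \<open>b + e = a - f\<close>
      also have "(a - f) + (a - f) = x" using that(1) by simp
      finally show ?thesis by simp
    qed
    show ?thesis
      by (rule average[OF phi_phi_A phi_phi_B])
  qed
  have D: "1 + (c\<^sup>2 * s 1 / (s 0 * t 1) + c\<^sup>2 * s 3 / (s 0 * t 3) - 1) =
      euler_E (q ^ 2) * euler_E (q ^ 4) * euler_E (q ^ 5) * euler_E (q ^ 10) / (euler_E q * euler_E (q ^ 20))"
    using eta_D by simp
  show ?thesis
    unfolding L infsumI[OF has_sum_bilateral_1] infsumI[OF has_sum_bilateral_2] infsumI[OF has_sum_bilateral_3] infsumI[OF has_sum_bilateral_4]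
    by (intro conjI has_sum_imp_summable[OF has_sum_bilateral_1] has_sum_imp_summable[OF has_sum_bilateral_2] has_sum_imp_summable[OF has_sum_bilateral_3]
        has_sum_imp_summable[OF has_sum_bilateral_4] L phi_phi_A phi_phi_B phi_phi_C D eta_E)
qed

end
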